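(* Let $N\ge2$ and $s\in[\tfrac12,1)$. Let $u\in LSC(\mathbb{R}^N_+)\cap\mathcal S$ be a nonnegative viscosity supersolution of $$\mathcal I_1^+u(x)+u^p(x)=0\ \text{ in }\mathbb{R}^N_+,\qquad u=0\ \text{ in }\mathbb{R}^N\setminus\mathbb{R}^N_+ .$$ If $0<p<\frac{1}{1-s}$, then $u(x)\equiv0$ in $\mathbb{R}^N_+$.
   Context: $\mathbb{R}^N_+=\{x=(x',x_N)\in\mathbb{R}^{N-1}\times\mathbb{R}: x_N>0\}$. For a unit vector $\xi\in\mathbb{R}^N$, $$\mathcal I_\xi u(x)=C_s\int_0^{+\infty}\frac{u(x+\tau\xi)+u(x-\tau\xi)-2u(x)}{\tau^{1+2s}}\,d\tau,$$ where $C_s>0$ is a normalizing constant depending only on $s$ (chosen so that $\mathcal I_\xi u(x)\to\langle D^2u(x)\xi,\xi\rangle$ as $s\to1^-$), and $\mathcal I_1^+u(x)=\sup_{|\xi|=1}\mathcal I_\xi u(x)$. $\mathcal S$ is the space of functions $u:\mathbb{R}^N\to\mathbb{R}$ such that (i) for every $x\in\mathbb{R}^N_+$ and unit vector $\xi$, the map $\tau\in\mathbb{R}\mapsto u(x+\tau\xi)$ is measurable; (ii) there are $\alpha\in[0,2s)$ and $C>0$ with $|u(x)|\le C(1+|x|)^\alpha$ for all $x\in\mathbb{R}^N$. $LSC(\mathbb{R}^N_+)$ means lower semicontinuous on $\mathbb{R}^N_+$. Viscosity supersolution: $u\in\mathcal S\cap LSC(\mathbb{R}^N_+)$ is a viscosity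 supersolution of $\mathcal I u+f(x,u)=0$ in $\mathbb{R}^N_+$ if for every $x_0\in\mathbb{R}^N_+$, $r>0$ with $B_r(x_0)\subseteq\mathbb{R}^N_+$ and $\varphi\in C^2(\overline{B_r(x_0)})$ with $\varphi(x_0)=u(x_0)$ and $\varphi\le u$ in $B_r(x_0)$, the function $\psi$ equal to $\varphi$ in $B_r(x_0)$ and to $u$ in $\mathbb{R}^N\setminus B_r(x_0)$ satisfies $\mathcal I\psi(x_0)+f(x_0,u(x_0))\le 0$. It is a supersolution of the problem with condition $u=0$ in $\mathbb{R}^N\setminus\mathbb{R}^N_+$ if this holds (with $f(x,u)=u^p$) and $u\ge0$ in $\mathbb{R}^N\setminus\mathbb{R}^N_+$. "Nonnegative" means $u\geq 0$ in $\mathbb{R}^N$. *)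

theory Defs
  imports "HOL-Analysis.Analysis"
begin

text \<open>The paper's half-space is the case where \<open>k\<close> is the last coordinate.\<close>

definition half_space :: "'n::finite \<Rightarrow> (real ^ 'n) set" where
  "half_space k = {x. x $ k > 0}"

text \<open>\<open>C2_with_jet B u g H\<close>, for open \<open>B\<close>: \<open>u\<close> is of class $C^2$ on the closure of \<open>B\<close>, that is,
  twice differentiable in \<open>B\<close> with gradient \<open>g\<close> and Hessian matrix \<open>H\<close>, and \<open>u\<close>, \<open>g\<close>, \<open>H\<close> are
  continuous up to the boundary. The values of \<open>g\<close> and \<open>H\<close> on the boundary are the continuous
  extensions, and nothing is required outside the closure.\<close>

definition C2_with_jet ::
  "(real ^ 'n) set \<Rightarrow> (real ^ 'n \<Rightarrow> real) \<Rightarrow> (real ^ 'n \<Rightarrow> real ^ 'n) \<Rightarrow> (real ^ 'n \<Rightarrow> real ^ 'n ^ 'n::finite) \<Rightarrow> bool"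
  where
  "C2_with_jet B u g H \<longleftrightarrow>
     (\<forall>x\<in>B. (u has_derivative (\<lambda>h. g x \<bullet> h)) (at x)) \<and>
     (\<forall>x\<in>B. (g has_derivative (\<lambda>h. H x *v h)) (at x)) \<and>
     continuous_on (closure B) u \<and> continuous_on (closure B) g \<and> continuous_on (closure B) H"

definition C2_closure :: "(real ^ 'n::finite) set \<Rightarrow> (real ^ 'n \<Rightarrow> real) \<Rightarrow> bool" where
  "C2_closure B u \<longleftrightarrow> (\<exists>g H. C2_with_jet B u g H)"

text \<open>The operator $\mathcal I_\xi$, with \<open>C s\<close> for the constant $C_s$. At the points where
  \<open>visc_supersol\<close> below evaluates it, the function is $C^2$ near the point, measurable along
  lines through it and of growth of order less than $2s$, so the integral converges absolutely.\<close>

definition I_dir :: "(real \<Rightarrow> real) \<Rightarrow> real \<Rightarrow> real ^ 'n \<Rightarrow> (real ^ 'n::finite \<Rightarrow> real) \<Rightarrow> real ^ 'n \<Rightarrow> real" where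
  "I_dir C s \<xi> u x =
     C s * (LINT \<tau>:{0<..}|lebesgue.
       (u (x + \<tau> *\<^sub>R \<xi>) + u (x - \<tau> *\<^sub>R \<xi>) - 2 * u x) / \<tau> powr (1 + 2 * s))"

text \<open>At the same points the supremum is over a set that is bounded above, so the real-valued
  supremum is the intended one.\<close>

definition I1_plus :: "(real \<Rightarrow> real) \<Rightarrow> real \<Rightarrow> (real ^ 'n::finite \<Rightarrow> real) \<Rightarrow> real ^ 'n \<Rightarrow> real" where
  "I1_plus C s u x = (SUP \<xi>\<in>{\<xi>. norm \<xi> = 1}. I_dir C s \<xi> u x)"

text \<open>\<open>C s > 0\<close> for \<open>0 < s < 1\<close>, and for every bounded $C^2$ function \<open>u\<close> on the whole space
  (bounded, so that all the integrals converge) $\mathcal I_\xi u(x)$ tends to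
  $\langle D^2u(x)\xi,\xi\rangle$ as \<open>s\<close> increases to 1. This amounts to \<open>C s / (2 * (1 - s))\<close>
  tending to 1. The type argument only records the dimension.\<close>

definition normalizing_constant :: "'n::finite itself \<Rightarrow> (real \<Rightarrow> real) \<Rightarrow> bool" where
  "normalizing_constant _ C \<longleftrightarrow>
     (\<forall>s. 0 < s \<and> s < 1 \<longrightarrow> C s > 0) \<and>
     (\<forall>(u :: real ^ 'n \<Rightarrow> real) g H x \<xi>.
        C2_with_jet UNIV u g H \<and> bounded (range u) \<and> norm \<xi> = 1 \<longrightarrow>
          ((\<lambda>s. I_dir C s \<xi> u x) \<longlongrightarrow> (H x *v \<xi>) \<bullet> \<xi>) (at_left 1))"

text \<open>The space $\mathcal S$ for the domain \<open>\<Omega>\<close>; measurable means Lebesgue measurable.\<close>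

definition S_space :: "real \<Rightarrow> (real ^ 'n::finite) set \<Rightarrow> (real ^ 'n \<Rightarrow> real) set" where
  "S_space s \<Omega> = {u.
     (\<forall>x\<in>\<Omega>. \<forall>\<xi>. norm \<xi> = 1 \<longrightarrow> (\<lambda>\<tau>::real. u (x + \<tau> *\<^sub>R \<xi>)) \<in> borel_measurable lebesgue) \<and>
     (\<exists>\<alpha> C. 0 \<le> \<alpha> \<and> \<alpha> < 2 * s \<and> 0 < C \<and> (\<forall>x. \<bar>u x\<bar> \<le> C * (1 + norm x) powr \<alpha>))}"

definition LSC :: "'a::topological_space set \<Rightarrow> ('a \<Rightarrow> real) set" where
  "LSC \<Omega> = {u. \<forall>x\<in>\<Omega>. \<forall>y < u x. eventually (\<lambda>z. y < u z) (at x within \<Omega>)}"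

text \<open>Viscosity supersolutions of $\mathcal I u + f(x,u) = 0$ in \<open>\<Omega>\<close>, for an operator \<open>I\<close>; the
  parameter \<open>s\<close> enters through $\mathcal S$ only.\<close>

definition visc_supersol ::
  "real \<Rightarrow> (real ^ 'n::finite) set \<Rightarrow> ((real ^ 'n \<Rightarrow> real) \<Rightarrow> real ^ 'n \<Rightarrow> real) \<Rightarrow>
   (real ^ 'n \<Rightarrow> real \<Rightarrow> real) \<Rightarrow> (real ^ 'n \<Rightarrow> real) \<Rightarrow> bool" where
  "visc_supersol s \<Omega> I f u \<longleftrightarrow>
     u \<in> S_space s \<Omega> \<inter> LSC \<Omega> \<and>
     (\<forall>x0\<in>\<Omega>. \<forall>r>0. \<forall>\<phi>.
        ball x0 r \<subseteq> \<Omega> \<and> C2_closure (ball x0 r) \<phi> \<and> \<phi> x0 = u x0 \<and> (\<forall>x\<in>ball x0 r. \<phi> x \<le> u x) \<longrightarrow>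
          I (\<lambda>x. if x \<in> ball x0 r then \<phi> x else u x) x0 + f x0 (u x0) \<le> 0)"

text \<open>Viscosity supersolutions of the same equation with the condition $u = 0$ outside \<open>\<Omega>\<close>.\<close>

definition visc_supersol_Dirichlet ::
  "real \<Rightarrow> (real ^ 'n::finite) set \<Rightarrow> ((real ^ 'n \<Rightarrow> real) \<Rightarrow> real ^ 'n \<Rightarrow> real) \<Rightarrow>
   (real ^ 'n \<Rightarrow> real \<Rightarrow> real) \<Rightarrow> (real ^ 'n \<Rightarrow> real) \<Rightarrow> bool" where
  "visc_supersol_Dirichlet s \<Omega> I f u \<longleftrightarrow> visc_supersol s \<Omega> I f u \<and> (\<forall>x. x \<notin> \<Omega> \<longrightarrow> 0 \<le> u x)"

end

theory Submission
  imports Defs "HOL-Real_Asymp.Real_Asymp"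
begin

text \<open>In a direction \<open>e\<close> parallel to the boundary, the supremum dominates the one-dimensional
  fractional Laplacian on whole lines, and for $s\ge1/2$ that operator is recurrent: there is a
  profile \<open>w\<close> tending to $-\infty$ at infinity on which it is positive off a compact set, namely
  $w(t)=-\frac12\ln(1+t^2)+4/(1+t^2)$. Suppose $u(x_0)>0$. The function
  $\delta\,w(\lambda t)-M|y|^2$, with \<open>t\<close> the coordinate along \<open>e\<close> and \<open>y\<close> the orthogonal part, both
  centred at $x_0$, touches \<open>u\<close> from below after adding a constant. Where the operator is positive on
  \<open>w\<close>, this contradicts the inequality for \<open>u\<close>; otherwise the contact point is close to $x_0$, where
  \<open>u\<close> is bounded below, and the inequality gives $0<(u(x_0)/2)^p\le O(\delta)$, which fails for small
  $\delta$.\<close>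

text \<open>On the line and for \<open>s = 1/2\<close>, the operator annihilates -ln |t| away from
  the origin. Removing the singularity makes the result negative everywhere, and this error is what
  the second summand of the profile has to repair. Both summands come from the Poisson kernel of the
  half-plane, so their values at \<open>s = 1/2\<close> are explicit; larger \<open>s\<close> is
  reduced to that case. The parameters decouple. The ball on which \<open>u\<close> exceeds half its
  central value fixes the dilation, and also \<open>M\<close>, which must keep the contact point
  inside the half-space; the amplitude \<delta> is chosen last. This order is possible because the
  penalty is constant along the chosen direction, so \<open>M\<close> is absent from the
  one-dimensional integral. In all other directions only an upper bound is needed, and there a
  concave term does no harm. Since \<open>u\<close> is nonnegative on the whole space, comparison is
  automatic wherever the test function lies at least \<open>u x0\<close> below its central value, on
  either side of the boundary.\<close>

section \<open>Integrable majorants for the singular kernel\<close>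

lemma set_integrable_bounded_by:
  fixes f g :: "'a::euclidean_space \<Rightarrow> real"
  assumes "set_integrable lebesgue A g" "A \<in> sets lebesgue" "f \<in> borel_measurable lebesgue"
    and "\<And>x. x \<in> A \<Longrightarrow> \<bar>f x\<bar> \<le> g x"
  shows "set_integrable lebesgue A f"
  unfolding set_integrable_def
proof (rule Bochner_Integration.integrable_bound)
  show "integrable lebesgue (\<lambda>x. indicator A x *\<^sub>R g x)"
    using assms(1) by (simp add: set_integrable_def)
  show "(\<lambda>x. indicat_real A x *\<^sub>R f x) \<in> borel_measurable lebesgue"
    using assms(2,3) by measurable
  show "AE x in lebesgue. norm (indicat_real A x *\<^sub>R f x) \<le> norm (indicator A x *\<^sub>R g x)"
    by (rule AE_I2) (use assms(4) in \<open>force simp: indicator_def\<close>)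
qed

text \<open>A majorant for second differences of a function that is $C^{1,1}$ near the base point and
  grows with order \<open>a\<close>.\<close>

definition kernel_bound :: "real \<Rightarrow> real \<Rightarrow> real \<Rightarrow> real \<Rightarrow> real" where
  "kernel_bound s a r \<tau> = (if \<tau> < r then \<tau>\<^sup>2 else \<tau> powr a) / \<tau> powr (1 + 2 * s)"

lemma kernel_bound_nonneg: "0 \<le> kernel_bound s a r \<tau>"
  by (simp add: kernel_bound_def)

text \<open>Below \<open>r\<close> the quotient is \<open>\<tau> powr (1 - 2 * s)\<close>, whose
  exponent exceeds -1 because \<open>s < 1\<close>; beyond \<open>r\<close> it is
  \<open>\<tau> powr (a - 1 - 2 * s)\<close>, whose exponent is below -1 because
  \<open>a < 2 * s\<close>.\<close>

lemma set_integrable_kernel_bound: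
  assumes "s < 1" "a < 2 * s" "0 < r"
  shows "set_integrable lebesgue {0<..} (kernel_bound s a r)"
proof -
  have "(\<lambda>\<tau>::real. \<tau> powr (1 - 2 * s)) absolutely_integrable_on {0..r}"
    using assms by (intro nonnegative_absolutely_integrable_1 integrable_on_powr_from_0) auto
  then have "(\<lambda>\<tau>::real. \<tau> powr (1 - 2 * s)) absolutely_integrable_on {0<..<r}"
    by (rule set_integrable_subset) auto
  also have "?this \<longleftrightarrow> kernel_bound s a r absolutely_integrable_on {0<..<r}"
    by (intro set_integrable_cong)
      (auto simp: kernel_bound_def powr_diff[symmetric] simp flip: powr_numeral)
  finally have 1: "kernel_bound s a r absolutely_integrable_on {0<..<r}" .
  have "(\<lambda>\<tau>::real. \<tau> powr (a - 1 - 2 * s)) absolutely_integrable_on {r..}"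
    using assms has_integral_powr_to_inf[of "a - 1 - 2 * s" r]
    by (intro nonnegative_absolutely_integrable_1) (auto simp: integrable_on_def)
  also have "?this \<longleftrightarrow> kernel_bound s a r absolutely_integrable_on {r..}"
    by (intro set_integrable_cong)
      (auto simp: kernel_bound_def powr_diff[symmetric] algebra_simps)
  finally have 2: "kernel_bound s a r absolutely_integrable_on {r..}" .
  have "{0<..} = {0<..<r} \<union> {r..}" using \<open>0 < r\<close> by auto
  then show ?thesis using set_integrable_Un[OF 1 2] by simp
qed

section \<open>Second differences and the one-dimensional operator\<close>

definition sdiff :: "(real \<Rightarrow> real) \<Rightarrow> real \<Rightarrow> real \<Rightarrow> real" where
  "sdiff f x \<tau> = f (x + \<tau>) + f (x - \<tau>) - 2 * f x"

text \<open>Mean value theorem twice: for the second difference as a function of \<tau>, which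
  vanishes at 0, and then for \<open>f'\<close> between \<open>x - \<sigma>\<close> and
  \<open>x + \<sigma>\<close>. Estimating \<sigma> by \<tau> costs a factor 2 against the sharp
  constant.\<close>

lemma sdiff_quadratic_bound:
  fixes f f' f'' :: "real \<Rightarrow> real"
  assumes f: "\<And>x. (f has_real_derivative f' x) (at x)"
    and f': "\<And>x. (f' has_real_derivative f'' x) (at x)"
    and L: "\<And>x. \<bar>f'' x\<bar> \<le> L" and "0 \<le> \<tau>"
  shows "\<bar>sdiff f x \<tau>\<bar> \<le> 2 * L * \<tau>\<^sup>2"
proof (cases "\<tau> = 0")
  case False
  with \<open>0 \<le> \<tau>\<close> have "0 < \<tau>" by simp
  have "((\<lambda>\<tau>. sdiff f x \<tau>) has_real_derivative (f' (x + \<tau>) - f' (x - \<tau>))) (at \<tau>)" for \<tau>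
    unfolding sdiff_def by (auto intro!: derivative_eq_intros DERIV_chain2[OF f])
  from MVT2[OF \<open>0 < \<tau>\<close> this] obtain \<sigma> where \<sigma>: "0 < \<sigma>" "\<sigma> < \<tau>"
    "sdiff f x \<tau> - sdiff f x 0 = (\<tau> - 0) * (f' (x + \<sigma>) - f' (x - \<sigma>))" by blast
  have "\<exists>z > x - \<sigma>. z < x + \<sigma> \<and> f' (x + \<sigma>) - f' (x - \<sigma>) = (x + \<sigma> - (x - \<sigma>)) * f'' z"
    using \<sigma> by (intro MVT2 f') auto
  then obtain z where z: "f' (x + \<sigma>) - f' (x - \<sigma>) = 2 * \<sigma> * f'' z" by auto
  have "\<bar>sdiff f x \<tau>\<bar> = 2 * (\<tau> * \<sigma>) * \<bar>f'' z\<bar>"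
    using \<sigma> z by (simp add: sdiff_def abs_mult)
  also have "\<dots> \<le> 2 * (\<tau> * \<tau>) * L"
    using \<sigma> L[of z] by (intro mult_mono mult_nonneg_nonneg) auto
  finally show ?thesis by (simp add: power2_eq_square algebra_simps)
qed (simp add: sdiff_def)

text \<open>The growth exponent $1/2$ is an arbitrary choice below $1\le 2s$; it makes the second
  differences integrable against $\tau^{-1-2s}$.\<close>

definition admissible :: "real \<Rightarrow> (real \<Rightarrow> real) \<Rightarrow> (real \<Rightarrow> real) \<Rightarrow> (real \<Rightarrow> real) \<Rightarrow> bool" where
  "admissible L f f' f'' \<longleftrightarrow>
     (\<forall>x. (f has_real_derivative f' x) (at x)) \<and>
     (\<forall>x. (f' has_real_derivative f'' x) (at x)) \<and>
     (\<forall>x. \<bar>f'' x\<bar> \<le> L) \<and> (\<forall>x. \<bar>f x\<bar> \<le> L * (1 + \<bar>x\<bar>) powr (1/2))"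

definition frac_lap :: "real \<Rightarrow> (real \<Rightarrow> real) \<Rightarrow> real \<Rightarrow> real" where
  "frac_lap s f x = (LINT \<tau>:{0<..}|lebesgue. sdiff f x \<tau> / \<tau> powr (1 + 2 * s))"

text \<open>The bound is uniform for \<open>x\<close> in a bounded set, so one integrable majorant
  serves all these \<open>x\<close>. The 4 is 1 + 1 + 2, the total weight of the three values in the
  second difference.\<close>

lemma admissible_sdiff_bound:
  assumes b: "admissible L f f' f''" and "0 < \<tau>" "\<bar>x\<bar> \<le> T"
  shows "\<bar>sdiff f x \<tau> / \<tau> powr (1 + 2 * s)\<bar> \<le> 4 * L * (2 + T) powr (1/2) * kernel_bound s (1/2) 1 \<tau>"
proof -
  have "0 \<le> L" using b by (auto simp: admissible_def dest!: spec[of _ 0])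
  have "0 \<le> T" using assms by linarith
  let ?c = "4 * L * (2 + T) powr (1/2)"
  have "\<bar>sdiff f x \<tau>\<bar> \<le> ?c * (if \<tau> < 1 then \<tau>\<^sup>2 else \<tau> powr (1/2))"
  proof (cases "\<tau> < 1")
    case True
    have "\<bar>sdiff f x \<tau>\<bar> \<le> 2 * L * \<tau>\<^sup>2"
      using b \<open>0 < \<tau>\<close> unfolding admissible_def by (intro sdiff_quadratic_bound) auto
    also have "\<dots> \<le> 4 * L * (2 + T) powr (1/2) * \<tau>\<^sup>2"
    proof (rule mult_right_mono)
      have "1 \<le> (2 + T) powr (1/2)" using \<open>0 \<le> T\<close> by (intro ge_one_powr_ge_zero) auto
      then have "L * 2 \<le> L * (4 * (2 + T) powr (1/2))" using \<open>0 \<le> L\<close> by (intro mult_left_mono) auto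
      then show "2 * L \<le> 4 * L * (2 + T) powr (1/2)" by (simp add: mult_ac)
    qed simp
    finally show ?thesis using True by simp
  next
    case False
    have *: "\<bar>f y\<bar> \<le> L * ((2 + T) powr (1/2) * \<tau> powr (1/2))" if "\<bar>y\<bar> \<le> T + \<tau>" for y
    proof -
      \<comment> \<open>Since \<tau> is at least 1, the constant part \<open>1 + T\<close> is at
        most \<open>(1 + T) * \<tau>\<close>.\<close>
      have "1 + \<bar>y\<bar> \<le> (2 + T) * \<tau>"
        using that False \<open>0 \<le> T\<close> mult_mono[of 1 \<tau> "1 + T" "1 + T"] by (simp add: algebra_simps)
      then have "(1 + \<bar>y\<bar>) powr (1/2) \<le> ((2 + T) * \<tau>) powr (1/2)"
        by (intro powr_mono2) auto
      also have "\<dots> = (2 + T) powr (1/2) * \<tau> powr (1/2)"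
        using \<open>0 \<le> T\<close> \<open>0 < \<tau>\<close> by (simp add: powr_mult)
      finally have "L * (1 + \<bar>y\<bar>) powr (1/2) \<le> L * ((2 + T) powr (1/2) * \<tau> powr (1/2))"
        using \<open>0 \<le> L\<close> by (intro mult_left_mono)
      moreover have "\<bar>f y\<bar> \<le> L * (1 + \<bar>y\<bar>) powr (1/2)" using b by (simp add: admissible_def)
      ultimately show ?thesis by linarith
    qed
    show ?thesis
    proof -
      have "\<bar>f (x + \<tau>)\<bar> \<le> L * ((2 + T) powr (1/2) * \<tau> powr (1/2))"
        "\<bar>f (x - \<tau>)\<bar> \<le> L * ((2 + T) powr (1/2) * \<tau> powr (1/2))"
        "\<bar>f x\<bar> \<le> L * ((2 + T) powr (1/2) * \<tau> powr (1/2))"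
        using assms(2,3) by (intro *; linarith)+
      then have "\<bar>sdiff f x \<tau>\<bar> \<le> 4 * (L * ((2 + T) powr (1/2) * \<tau> powr (1/2)))"
        unfolding sdiff_def by linarith
      then show ?thesis using False by (simp add: mult_ac)
    qed
  qed
  then show ?thesis
    using \<open>0 < \<tau>\<close> by (simp add: kernel_bound_def divide_right_mono)
qed

lemma admissible_sdiff_measurable:
  assumes "admissible L f f' f''"
  shows "(\<lambda>\<tau>. sdiff f x \<tau> / \<tau> powr e) \<in> borel_measurable lebesgue"
proof -
  have "continuous_on UNIV f"
    using assms by (auto simp: admissible_def continuous_on_eq_continuous_at intro: DERIV_isCont)
  then have "f \<in> borel_measurable borel" by (rule borel_measurable_continuous_onI)
  then have "(\<lambda>\<tau>. sdiff f x \<tau> / \<tau> powr e) \<in> borel_measurable borel"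
    unfolding sdiff_def by measurable
  then show ?thesis by (simp add: measurable_completion)
qed

lemma admissible_integrable:
  assumes "admissible L f f' f''" "1/2 \<le> s" "s < 1"
  shows "set_integrable lebesgue {0<..} (\<lambda>\<tau>. sdiff f x \<tau> / \<tau> powr (1 + 2 * s))"
proof (rule set_integrable_bounded_by)
  show "set_integrable lebesgue {0<..} (\<lambda>\<tau>. 4 * L * (2 + \<bar>x\<bar>) powr (1/2) * kernel_bound s (1/2) 1 \<tau>)"
    using assms by (intro set_integrable_mult_right set_integrable_kernel_bound) auto
  show "(\<lambda>\<tau>. sdiff f x \<tau> / \<tau> powr (1 + 2 * s)) \<in> borel_measurable lebesgue"
    by (rule admissible_sdiff_measurable[OF assms(1)])
qed (use admissible_sdiff_bound[OF assms(1)] in auto)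

text \<open>Serves the bounded region where the barrier gives no sign: there it suffices to know how
  negative the operator can become.\<close>

lemma admissible_frac_lap_bounded:
  assumes "admissible L f f' f''" "1/2 \<le> s" "s < 1"
  shows "\<exists>K. \<forall>x. \<bar>x\<bar> \<le> T \<longrightarrow> - K \<le> frac_lap s f x"
proof -
  let ?g = "\<lambda>\<tau>. 4 * L * (2 + T) powr (1/2) * kernel_bound s (1/2) 1 \<tau>"
  have g: "set_integrable lebesgue {0<..} ?g"
    using assms by (intro set_integrable_mult_right set_integrable_kernel_bound) auto
  have "- (LINT \<tau>:{0<..}|lebesgue. ?g \<tau>) \<le> frac_lap s f x" if "\<bar>x\<bar> \<le> T" for x
  proof -
    have "(LINT \<tau>:{0<..}|lebesgue. - ?g \<tau>) \<le> frac_lap s f x"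
      unfolding frac_lap_def
    proof (rule set_integral_mono)
      show "set_integrable lebesgue {0<..} (\<lambda>\<tau>. - ?g \<tau>)"
        using set_integrable_mult_right[OF g, of "-1"] by simp
      show "- ?g \<tau> \<le> sdiff f x \<tau> / \<tau> powr (1 + 2 * s)" if "\<tau> \<in> {0<..}" for \<tau>
        using admissible_sdiff_bound[OF assms(1) _ \<open>\<bar>x\<bar> \<le> T\<close>, of \<tau> s, THEN abs_le_D2] that
        by (simp only: greaterThan_iff minus_le_iff)
    qed (rule admissible_integrable[OF assms])
    then show ?thesis using set_integral_uminus[OF g] by simp
  qed
  then show ?thesis by blast
qed

text \<open>The critical case $s=1/2$ controls $s>1/2$: the weight $\tau^{1-2s}$ is decreasing and the
  second difference changes sign once.\<close>

lemma frac_lap_ge_of_sign_change: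
  assumes b: "admissible L f f' f''" and s: "1/2 \<le> s" "s < 1" and "0 < \<rho>"
    and pos: "\<And>\<tau>. 0 < \<tau> \<Longrightarrow> \<tau> \<le> \<rho> \<Longrightarrow> 0 \<le> sdiff f x \<tau>"
    and neg: "\<And>\<tau>. \<rho> \<le> \<tau> \<Longrightarrow> sdiff f x \<tau> \<le> 0"
  shows "\<rho> powr (1 - 2 * s) * frac_lap (1/2) f x \<le> frac_lap s f x"
proof -
  have "(LINT \<tau>:{0<..}|lebesgue. \<rho> powr (1 - 2 * s) * (sdiff f x \<tau> / \<tau> powr (1 + 2 * (1/2)))) \<le>
    (LINT \<tau>:{0<..}|lebesgue. sdiff f x \<tau> / \<tau> powr (1 + 2 * s))"
  proof (intro set_integral_mono admissible_integrable[OF b s] set_integrable_mult_right admissible_integrable[OF b])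
    fix \<tau> :: real assume "\<tau> \<in> {0<..}"
    then have \<tau>: "0 < \<tau>" by simp
    \<comment> \<open>Both factors pass from nonnegative to nonpositive at the same point
      \<rho>.\<close>
    have "0 \<le> sdiff f x \<tau> * (\<tau> powr (1 - 2 * s) - \<rho> powr (1 - 2 * s))"
    proof (cases "\<tau> \<le> \<rho>")
      case True
      then show ?thesis using pos[OF \<tau> True] \<tau> s \<open>0 < \<rho>\<close>
        by (intro mult_nonneg_nonneg) (auto intro!: powr_mono2')
    next
      case False
      then show ?thesis using neg[of \<tau>] \<tau> s \<open>0 < \<rho>\<close>
        by (intro mult_nonpos_nonpos) (auto intro!: powr_mono2')
    qed
    then have "\<rho> powr (1 - 2 * s) * sdiff f x \<tau> \<le> sdiff f x \<tau> * \<tau> powr (1 - 2 * s)"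
      by (simp add: algebra_simps)
    then have "\<rho> powr (1 - 2 * s) * sdiff f x \<tau> / \<tau> powr 2 \<le> sdiff f x \<tau> * \<tau> powr (1 - 2 * s) / \<tau> powr 2"
      using \<tau> by (intro divide_right_mono) auto
    also have "\<dots> = sdiff f x \<tau> * \<tau> powr (1 - 2 * s - 2)"
      using powr_diff[of \<tau> "1 - 2 * s" 2] by (simp only: times_divide_eq_right)
    also have "\<dots> = sdiff f x \<tau> * \<tau> powr (- (1 + 2 * s))" by (simp add: algebra_simps)
    also have "\<dots> = sdiff f x \<tau> / \<tau> powr (1 + 2 * s)" by (simp only: powr_minus divide_inverse)
    finally show "\<rho> powr (1 - 2 * s) * (sdiff f x \<tau> / \<tau> powr (1 + 2 * (1/2))) \<le> sdiff f x \<tau> / \<tau> powr (1 + 2 * s)"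
      by simp
  qed auto
  then show ?thesis by (simp only: frac_lap_def set_integral_mult_right)
qed

text \<open>Fundamental theorem of calculus on the open half-line; integrability is already known
  from admissibility. At \<open>s = 1/2\<close> the weight is \<open>\<tau>\<^sup>2\<close>, so the
  profiles below have elementary primitives.\<close>

lemma frac_lap_half_eq:
  assumes b: "admissible L f f' f''"
    and F: "\<And>\<tau>. 0 < \<tau> \<Longrightarrow> (F has_real_derivative sdiff f x \<tau> / \<tau>\<^sup>2) (at \<tau>)"
    and 0: "(F \<longlongrightarrow> 0) (at_right 0)" and top: "(F \<longlongrightarrow> l) at_top"
  shows "frac_lap (1/2) f x = l"
proof -
  have int: "set_integrable lebesgue {0<..} (\<lambda>\<tau>. sdiff f x \<tau> / \<tau>\<^sup>2)"
    using admissible_integrable[OF b, of "1/2" x]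
    by (rule iffD1[OF set_integrable_cong, rotated -1]) auto
  have cont: "continuous_on UNIV f"
    using b by (auto simp: admissible_def continuous_on_eq_continuous_at intro: DERIV_isCont)
  \<comment> \<open>The fundamental theorem is applied over \<open>lborel\<close>. Borel
    measurability of the integrand makes its integral there agree with the one over
    \<open>lebesgue\<close>.\<close>
  have bm: "(\<lambda>\<tau>. indicat_real {0<..} \<tau> *\<^sub>R (sdiff f x \<tau> / \<tau>\<^sup>2)) \<in> borel_measurable lborel"
  proof -
    have "f \<in> borel_measurable borel" using cont by (rule borel_measurable_continuous_onI)
    then show ?thesis unfolding sdiff_def by measurable
  qed
  have int': "set_integrable lborel {0<..} (\<lambda>\<tau>. sdiff f x \<tau> / \<tau>\<^sup>2)"
    using int bm by (simp add: set_integrable_def integrable_completion)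
  have "(LBINT \<tau>=0..\<infinity>. sdiff f x \<tau> / \<tau>\<^sup>2) = l - 0"
  proof (rule interval_integral_FTC_integrable)
    show "(F has_vector_derivative sdiff f x \<tau> / \<tau>\<^sup>2) (at \<tau>)" if "0 < ereal \<tau>" for \<tau>
      using F[of \<tau>] that by (simp add: has_real_derivative_iff_has_vector_derivative zero_ereal_def)
    have "continuous_on {0<..} (\<lambda>\<tau>. sdiff f x \<tau> / \<tau>\<^sup>2)"
      unfolding sdiff_def by (intro continuous_intros continuous_on_compose2[OF cont]) auto
    then show "isCont (\<lambda>\<tau>. sdiff f x \<tau> / \<tau>\<^sup>2) \<tau>" if "0 < ereal \<tau>" for \<tau>
      using that by (simp add: continuous_on_eq_continuous_at)
    show "set_integrable lborel (einterval 0 \<infinity>) (\<lambda>\<tau>. sdiff f x \<tau> / \<tau>\<^sup>2)"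
      using int' by (simp add: einterval_def greaterThan_def zero_ereal_def)
    show "((F \<circ> real_of_ereal) \<longlongrightarrow> 0) (at_right 0)"
      using 0 by (simp add: zero_ereal_def ereal_tendsto_simps)
    show "((F \<circ> real_of_ereal) \<longlongrightarrow> l) (at_left \<infinity>)"
      using top by (simp add: ereal_tendsto_simps)
  qed simp
  also have "(LBINT \<tau>=0..\<infinity>. sdiff f x \<tau> / \<tau>\<^sup>2) = (LINT \<tau>:{0<..}|lborel. sdiff f x \<tau> / \<tau>\<^sup>2)"
    by (simp add: interval_lebesgue_integral_def einterval_def greaterThan_def zero_ereal_def)
  also have "\<dots> = (LINT \<tau>:{0<..}|lebesgue. sdiff f x \<tau> / \<tau>\<^sup>2)"
    unfolding set_lebesgue_integral_def using bm by (simp add: integral_completion)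
  also have "\<dots> = frac_lap (1/2) f x"
    unfolding frac_lap_def by (rule set_lebesgue_integral_cong) auto
  finally show ?thesis by simp
qed

section \<open>The logarithmic and the rational profile\<close>

text \<open>This is -ln |x + i|: the harmonic extension of -ln |x| to the upper half-plane, read at
  height one. The shift removes the singularity and keeps the descent to minus infinity.\<close>

definition barrier_log :: "real \<Rightarrow> real" where
  "barrier_log x = - ln (1 + x\<^sup>2) / 2"

text \<open>This is \<open>pi\<close> times the Poisson kernel at height one, and equals
  \<open>- frac_lap (1/2) barrier_log x / pi\<close>.\<close>

definition barrier_bump :: "real \<Rightarrow> real" where
  "barrier_bump x = 1 / (1 + x\<^sup>2)"

lemma one_plus_square_pos: "0 < 1 + (x::real)\<^sup>2"
  by (simp add: add_pos_nonneg)

lemma one_plus_square_neq: "1 + (x::real)\<^sup>2 \<noteq> 0"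
  using one_plus_square_pos[of x] by simp

lemma admissible_log:
  "admissible 6 barrier_log (\<lambda>x. - x / (1 + x\<^sup>2)) (\<lambda>x. (x\<^sup>2 - 1) / (1 + x\<^sup>2)\<^sup>2)"
  unfolding admissible_def
proof (intro conjI allI)
  fix x :: real
  note [simp] = one_plus_square_neq[of x] one_plus_square_pos[of x]
  have "((\<lambda>x. ln (1 + x\<^sup>2)) has_real_derivative 2 * x / (1 + x\<^sup>2)) (at x)"
    by (auto intro!: derivative_eq_intros)
  from DERIV_cmult[OF this, of "- 1 / 2"]
  show "(barrier_log has_real_derivative - x / (1 + x\<^sup>2)) (at x)"
    unfolding barrier_log_def[abs_def] by simp
  have "((\<lambda>x. 1 + x\<^sup>2) has_real_derivative 2 * x) (at x)"
    by (auto intro!: derivative_eq_intros)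
  from DERIV_divide[OF DERIV_minus[OF DERIV_ident] this one_plus_square_neq]
  show "((\<lambda>x. - x / (1 + x\<^sup>2)) has_real_derivative (x\<^sup>2 - 1) / (1 + x\<^sup>2)\<^sup>2) (at x)"
    by (rule DERIV_cong) (simp add: power2_eq_square algebra_simps)
  have "\<bar>x\<^sup>2 - 1\<bar> \<le> 1 + x\<^sup>2" by (simp add: abs_le_iff)
  also have "\<dots> \<le> (1 + x\<^sup>2)\<^sup>2" by (rule self_le_power) auto
  finally have "\<bar>x\<^sup>2 - 1\<bar> / (1 + x\<^sup>2)\<^sup>2 \<le> 1"
    by (subst divide_le_eq_1_pos) auto
  from order_trans[OF this, of 6]
  show "\<bar>(x\<^sup>2 - 1) / (1 + x\<^sup>2)\<^sup>2\<bar> \<le> 6" by simp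
  have "1 + x\<^sup>2 \<le> (1 + \<bar>x\<bar>)\<^sup>2" by (simp add: power2_eq_square algebra_simps)
  then have "ln (1 + x\<^sup>2) \<le> ln ((1 + \<bar>x\<bar>)\<^sup>2)" by (subst ln_le_cancel_iff) auto
  \<comment> \<open>Passing to the square root lets the inequality ln y \<le> y yield growth of
    order 1/2.\<close>
  also have "\<dots> = 4 * ln ((1 + \<bar>x\<bar>) powr (1/2))" by (simp add: ln_realpow ln_powr)
  also have "\<dots> \<le> 4 * (1 + \<bar>x\<bar>) powr (1/2)" by (intro mult_left_mono ln_bound) auto
  finally have "ln (1 + x\<^sup>2) \<le> 4 * (1 + \<bar>x\<bar>) powr (1/2)" .
  moreover have "0 \<le> ln (1 + x\<^sup>2)" by simp
  moreover have "0 \<le> (1 + \<bar>x\<bar>) powr (1/2)" by simp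
  ultimately show "\<bar>barrier_log x\<bar> \<le> 6 * (1 + \<bar>x\<bar>) powr (1/2)"
    unfolding barrier_log_def by linarith
qed

lemma barrier_log_deriv: "(barrier_log has_real_derivative - x / (1 + x\<^sup>2)) (at x)"
  using admissible_log by (simp add: admissible_def)

lemma admissible_bump:
  "admissible 6 barrier_bump (\<lambda>x. - 2 * x / (1 + x\<^sup>2)\<^sup>2) (\<lambda>x. (6 * x\<^sup>2 - 2) / (1 + x\<^sup>2) ^ 3)"
  unfolding admissible_def
proof (intro conjI allI)
  fix x :: real
  note [simp] = one_plus_square_neq[of x] one_plus_square_pos[of x]
  show "(barrier_bump has_real_derivative - 2 * x / (1 + x\<^sup>2)\<^sup>2) (at x)"
    unfolding barrier_bump_def[abs_def] using one_plus_square_neq[of x]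
    by (auto intro!: derivative_eq_intros simp: power2_eq_square)
  have 1: "((\<lambda>x. - 2 * x) has_real_derivative - 2) (at x)"
    by (auto intro!: derivative_eq_intros)
  have 2: "((\<lambda>x. (1 + x\<^sup>2)\<^sup>2) has_real_derivative 2 * (1 + x\<^sup>2) * (2 * x)) (at x)"
    by (auto intro!: derivative_eq_intros)
  have "((\<lambda>x. - 2 * x / (1 + x\<^sup>2)\<^sup>2) has_real_derivative
      (- 2 * (1 + x\<^sup>2)\<^sup>2 + 2 * x * (2 * (1 + x\<^sup>2) * (2 * x))) / ((1 + x\<^sup>2)\<^sup>2)\<^sup>2) (at x)"
    using DERIV_divide[OF 1 2] by (simp add: power2_eq_square[of "(1 + x\<^sup>2)\<^sup>2"])
  also have "- 2 * (1 + x\<^sup>2)\<^sup>2 + 2 * x * (2 * (1 + x\<^sup>2) * (2 * x)) = (1 + x\<^sup>2) * (6 * x\<^sup>2 - 2)"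
    by (simp add: power2_eq_square algebra_simps)
  also have "\<dots> / ((1 + x\<^sup>2)\<^sup>2)\<^sup>2 = (6 * x\<^sup>2 - 2) / (1 + x\<^sup>2) ^ 3"
  proof -
    have "a * b / (a\<^sup>2)\<^sup>2 = b / a ^ 3" if "a \<noteq> 0" for a b :: real
      using that by (simp add: field_simps eval_nat_numeral)
    then show ?thesis using one_plus_square_neq by blast
  qed
  finally show "((\<lambda>x. - 2 * x / (1 + x\<^sup>2)\<^sup>2) has_real_derivative (6 * x\<^sup>2 - 2) / (1 + x\<^sup>2) ^ 3) (at x)" .
  \<comment> \<open>This estimate is the source of the constant 6 shared by both profiles.\<close>
  have "\<bar>6 * x\<^sup>2 - 2\<bar> \<le> 6 * (1 + x\<^sup>2)" by (simp add: abs_le_iff)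
  also have "\<dots> \<le> 6 * (1 + x\<^sup>2) ^ 3" using self_le_power[of "1 + x\<^sup>2" 3] by simp
  finally have "\<bar>6 * x\<^sup>2 - 2\<bar> / (1 + x\<^sup>2) ^ 3 \<le> 6" by (simp add: divide_le_eq)
  then show "\<bar>(6 * x\<^sup>2 - 2) / (1 + x\<^sup>2) ^ 3\<bar> \<le> 6" by simp
  have "1 \<le> (1 + \<bar>x\<bar>) powr (1/2)" by (intro ge_one_powr_ge_zero) auto
  moreover have "\<bar>barrier_bump x\<bar> \<le> 1" by (simp add: barrier_bump_def divide_le_eq)
  ultimately show "\<bar>barrier_bump x\<bar> \<le> 6 * (1 + \<bar>x\<bar>) powr (1/2)" by linarith
qed

text \<open>Written so that the sign change can be read off: for nonzero \<tau> the product is below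
  \<open>(1 + x\<^sup>2)\<^sup>2\<close> exactly while
  \<open>\<tau>\<^sup>2 < 2 * (x\<^sup>2 - 1)\<close>. The second difference of the logarithm
  compares these two quantities.\<close>

lemma shifted_product:
  "(1 + (x + \<tau>)\<^sup>2) * (1 + (x - \<tau>)\<^sup>2) = (1 + x\<^sup>2)\<^sup>2 + \<tau>\<^sup>2 * (\<tau>\<^sup>2 - 2 * (x\<^sup>2 - 1))" for x \<tau> :: real
  by (simp add: power2_eq_square algebra_simps)

lemma sdiff_barrier_log:
  "sdiff barrier_log x \<tau> = (ln ((1 + x\<^sup>2)\<^sup>2) - ln ((1 + x\<^sup>2)\<^sup>2 + \<tau>\<^sup>2 * (\<tau>\<^sup>2 - 2 * (x\<^sup>2 - 1)))) / 2"
  unfolding shifted_product[symmetric] sdiff_def barrier_log_def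
  by (simp add: ln_mult ln_realpow one_plus_square_pos one_plus_square_neq diff_divide_distrib add_divide_distrib)

text \<open>Over the common positive denominator the sign is that of
  \<open>3 * x\<^sup>2 - 1 - \<tau>\<^sup>2\<close>, so when \<open>3 * x\<^sup>2 > 1\<close> there
  is a single sign change on the positive axis.\<close>

lemma sdiff_barrier_bump:
  "sdiff barrier_bump x \<tau> =
     2 * \<tau>\<^sup>2 * (3 * x\<^sup>2 - 1 - \<tau>\<^sup>2) / ((1 + x\<^sup>2) * ((1 + (x + \<tau>)\<^sup>2) * (1 + (x - \<tau>)\<^sup>2)))"
proof -
  have "1 / a + 1 / b - 2 * (1 / c) = (a * c + b * c - 2 * (a * b)) / (c * (a * b))"
    if "a \<noteq> 0" "b \<noteq> 0" "c \<noteq> 0" for a b c :: real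
    using that by (simp add: field_simps)
  from this[OF one_plus_square_neq one_plus_square_neq one_plus_square_neq, of "x + \<tau>" "x - \<tau>" x]
  show ?thesis unfolding sdiff_def barrier_bump_def
    by (simp add: power2_eq_square algebra_simps)
qed

text \<open>This is the boundary term at 0 when the integral of
  \<open>sdiff f x \<tau> / \<tau>\<^sup>2\<close> is integrated by parts.\<close>

lemma sdiff_over_tendsto_0:
  assumes "admissible L f f' f''"
  shows "((\<lambda>\<tau>. sdiff f x \<tau> / \<tau>) \<longlongrightarrow> 0) (at_right 0)"
proof (rule Lim_null_comparison)
  show "\<forall>\<^sub>F \<tau> in at_right 0. norm (sdiff f x \<tau> / \<tau>) \<le> 2 * L * \<tau>"
  proof (rule eventually_mono[OF eventually_at_right_less])
    fix \<tau> :: real assume "0 < \<tau>"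
    moreover have "\<bar>sdiff f x \<tau>\<bar> \<le> 2 * L * \<tau>\<^sup>2"
      using assms \<open>0 < \<tau>\<close> unfolding admissible_def by (intro sdiff_quadratic_bound) auto
    ultimately show "norm (sdiff f x \<tau> / \<tau>) \<le> 2 * L * \<tau>"
      by (simp add: divide_le_eq power2_eq_square mult_ac)
  qed
  show "((\<lambda>\<tau>. 2 * L * \<tau>) \<longlongrightarrow> 0) (at_right 0)" by (auto intro!: tendsto_eq_intros)
qed

section \<open>Explicit values at s = 1/2\<close>

text \<open>Together with \<open>log_part\<close> this is the basis for partial fractions over the
  denominator \<open>(1 + (x + \<tau>)\<^sup>2) * (1 + (x - \<tau>)\<^sup>2)\<close>: the two
  derivatives have numerators \<open>2 * (1 + x\<^sup>2 + \<tau>\<^sup>2)\<close> and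
  \<open>2 * x * (1 + x\<^sup>2 - \<tau>\<^sup>2)\<close>.\<close>

definition arctan_part :: "real \<Rightarrow> real \<Rightarrow> real" where
  "arctan_part x \<tau> = arctan (x + \<tau>) - arctan (x - \<tau>)"

definition log_part :: "real \<Rightarrow> real \<Rightarrow> real" where
  "log_part x \<tau> = barrier_log (x - \<tau>) - barrier_log (x + \<tau>)"

lemma arctan_part_limits:
  "(arctan_part x \<longlongrightarrow> 0) (at_right 0)" "(arctan_part x \<longlongrightarrow> pi) at_top"
proof -
  have "((\<lambda>\<tau>. arctan (x + \<tau>) - arctan (x - \<tau>)) \<longlongrightarrow> arctan (x + 0) - arctan (x - 0)) (at_right 0)"
    by (intro tendsto_intros)
  then show "(arctan_part x \<longlongrightarrow> 0) (at_right 0)" by (simp add: arctan_part_def[abs_def])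
  show "(arctan_part x \<longlongrightarrow> pi) at_top" unfolding arctan_part_def[abs_def] by real_asymp
qed

text \<open>Because both limits vanish, \<open>log_part\<close> contributes nothing to the
  integrals; each value is \<open>pi\<close> times the coefficient of
  \<open>arctan_part\<close>.\<close>

lemma log_part_limits:
  "(log_part x \<longlongrightarrow> 0) (at_right 0)" "(log_part x \<longlongrightarrow> 0) at_top"
proof -
  have "((\<lambda>\<tau>. barrier_log (x - \<tau>) - barrier_log (x + \<tau>)) \<longlongrightarrow> barrier_log (x - 0) - barrier_log (x + 0)) (at_right 0)"
    unfolding barrier_log_def by (intro tendsto_intros) (auto simp: one_plus_square_neq)
  then show "(log_part x \<longlongrightarrow> 0) (at_right 0)" by (simp add: log_part_def[abs_def])
  show "(log_part x \<longlongrightarrow> 0) at_top" unfolding log_part_def[abs_def] barrier_log_def by real_asymp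
qed

lemma arctan_part_deriv:
  "(arctan_part x has_real_derivative
     2 * (1 + x\<^sup>2 + \<tau>\<^sup>2) / ((1 + (x + \<tau>)\<^sup>2) * (1 + (x - \<tau>)\<^sup>2))) (at \<tau>)"
proof -
  have "(arctan_part x has_real_derivative 1 / (1 + (x + \<tau>)\<^sup>2) + 1 / (1 + (x - \<tau>)\<^sup>2)) (at \<tau>)"
    unfolding arctan_part_def[abs_def] by (auto intro!: derivative_eq_intros simp: inverse_eq_divide)
  also have "1 / (1 + (x + \<tau>)\<^sup>2) + 1 / (1 + (x - \<tau>)\<^sup>2) =
      ((1 + (x - \<tau>)\<^sup>2) + (1 + (x + \<tau>)\<^sup>2)) / ((1 + (x + \<tau>)\<^sup>2) * (1 + (x - \<tau>)\<^sup>2))"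
    by (simp add: one_plus_square_neq add_divide_eq_iff divide_add_eq_iff)
  finally show ?thesis by (simp add: power2_eq_square algebra_simps)
qed

lemma log_part_deriv:
  "(log_part x has_real_derivative
     2 * x * (1 + x\<^sup>2 - \<tau>\<^sup>2) / ((1 + (x + \<tau>)\<^sup>2) * (1 + (x - \<tau>)\<^sup>2))) (at \<tau>)"
proof -
  have "(log_part x has_real_derivative (x + \<tau>) / (1 + (x + \<tau>)\<^sup>2) + (x - \<tau>) / (1 + (x - \<tau>)\<^sup>2)) (at \<tau>)"
    unfolding log_part_def[abs_def]
    by (auto intro!: derivative_eq_intros DERIV_chain2[OF barrier_log_deriv] simp: diff_divide_distrib add_divide_distrib)
  also have "(x + \<tau>) / (1 + (x + \<tau>)\<^sup>2) + (x - \<tau>) / (1 + (x - \<tau>)\<^sup>2) =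
      ((x + \<tau>) * (1 + (x - \<tau>)\<^sup>2) + (x - \<tau>) * (1 + (x + \<tau>)\<^sup>2)) / ((1 + (x + \<tau>)\<^sup>2) * (1 + (x - \<tau>)\<^sup>2))"
    by (simp add: one_plus_square_neq add_divide_eq_iff divide_add_eq_iff)
  finally show ?thesis by (simp add: power2_eq_square algebra_simps)
qed

text \<open>The operator at \<open>s = 1/2\<close> is \<open>pi\<close> times the derivative in the
  height y, at y = 0, of the harmonic extension. Here the extension is (1 + y) / (x^2 + (1 + y)^2),
  which predicts the value; the proof integrates directly.\<close>

lemma frac_lap_half_barrier_bump: "frac_lap (1/2) barrier_bump x = (x\<^sup>2 - 1) / (1 + x\<^sup>2)\<^sup>2 * pi"
proof (rule frac_lap_half_eq[OF admissible_bump])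
  let ?A = "1 + x\<^sup>2"
  \<comment> \<open>The coefficients solve the linear system that matches the numerator
    \<open>3 * x\<^sup>2 - 1 - \<tau>\<^sup>2\<close> of the second difference.\<close>
  let ?F = "\<lambda>\<tau>. (x\<^sup>2 - 1) / ?A\<^sup>2 * arctan_part x \<tau> + 2 * x / ?A\<^sup>2 * log_part x \<tau>"
  fix \<tau> :: real assume "0 < \<tau>"
  let ?P = "(1 + (x + \<tau>)\<^sup>2) * (1 + (x - \<tau>)\<^sup>2)"
  have "(?F has_real_derivative (x\<^sup>2 - 1) / ?A\<^sup>2 * (2 * (?A + \<tau>\<^sup>2) / ?P) + 2 * x / ?A\<^sup>2 * (2 * x * (?A - \<tau>\<^sup>2) / ?P)) (at \<tau>)"
    by (intro DERIV_add DERIV_cmult arctan_part_deriv log_part_deriv)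
  also have "(x\<^sup>2 - 1) / ?A\<^sup>2 * (2 * (?A + \<tau>\<^sup>2) / ?P) + 2 * x / ?A\<^sup>2 * (2 * x * (?A - \<tau>\<^sup>2) / ?P) =
      ((x\<^sup>2 - 1) * (2 * (?A + \<tau>\<^sup>2)) + 2 * x * (2 * x * (?A - \<tau>\<^sup>2))) / (?A\<^sup>2 * ?P)"
    by (simp only: times_divide_times_eq add_divide_distrib)
  also have "(x\<^sup>2 - 1) * (2 * (?A + \<tau>\<^sup>2)) + 2 * x * (2 * x * (?A - \<tau>\<^sup>2)) = ?A * (2 * (3 * x\<^sup>2 - 1 - \<tau>\<^sup>2))"
    by (simp add: power2_eq_square algebra_simps)
  also have "\<dots> / (?A\<^sup>2 * ?P) = sdiff barrier_bump x \<tau> / \<tau>\<^sup>2"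
    unfolding sdiff_barrier_bump using \<open>0 < \<tau>\<close> one_plus_square_neq[of x]
    by (simp add: power2_eq_square)
  finally show "(?F has_real_derivative sdiff barrier_bump x \<tau> / \<tau>\<^sup>2) (at \<tau>)" .
next
  show "((\<lambda>\<tau>. (x\<^sup>2 - 1) / (1 + x\<^sup>2)\<^sup>2 * arctan_part x \<tau> + 2 * x / (1 + x\<^sup>2)\<^sup>2 * log_part x \<tau>) \<longlongrightarrow> 0) (at_right 0)"
    by (intro tendsto_add_zero tendsto_mult_right_zero arctan_part_limits log_part_limits)
  show "((\<lambda>\<tau>. (x\<^sup>2 - 1) / (1 + x\<^sup>2)\<^sup>2 * arctan_part x \<tau> + 2 * x / (1 + x\<^sup>2)\<^sup>2 * log_part x \<tau>) \<longlongrightarrow>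
      (x\<^sup>2 - 1) / (1 + x\<^sup>2)\<^sup>2 * pi) at_top"
    using tendsto_add[OF tendsto_mult_left[OF arctan_part_limits(2)] tendsto_mult_left[OF log_part_limits(2)]]
    by (simp only: mult_zero_right add_0_right)
qed

lemma frac_lap_half_barrier_log: "frac_lap (1/2) barrier_log x = - pi / (1 + x\<^sup>2)"
proof (rule frac_lap_half_eq[OF admissible_log])
  let ?A = "1 + x\<^sup>2"
  \<comment> \<open>Integration by parts: the last term is the boundary term, and what remains to
    integrate is the rational function \<open>D' / \<tau>\<close>, whose partial fractions give the
    first two coefficients.\<close>
  let ?F = "\<lambda>\<tau>. - 1 / ?A * arctan_part x \<tau> + x / ?A * log_part x \<tau> - sdiff barrier_log x \<tau> / \<tau>"
  fix \<tau> :: real assume "0 < \<tau>"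
  let ?P = "(1 + (x + \<tau>)\<^sup>2) * (1 + (x - \<tau>)\<^sup>2)"
  have "?P \<noteq> 0" by (simp add: one_plus_square_neq)
  define D' where "D' = - (x + \<tau>) / (1 + (x + \<tau>)\<^sup>2) + (x - \<tau>) / (1 + (x - \<tau>)\<^sup>2)"
  have "(sdiff barrier_log x has_real_derivative D') (at \<tau>)"
    unfolding sdiff_def[abs_def] D'_def
    by (auto intro!: derivative_eq_intros DERIV_chain2[OF barrier_log_deriv] simp: diff_divide_distrib add_divide_distrib)
  then have *: "((\<lambda>\<tau>. sdiff barrier_log x \<tau> / \<tau>) has_real_derivative
      (D' * \<tau> - sdiff barrier_log x \<tau> * 1) / (\<tau> * \<tau>)) (at \<tau>)"
    using \<open>0 < \<tau>\<close> by (intro DERIV_divide DERIV_ident) auto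
  have "D' = (- (x + \<tau>) * (1 + (x - \<tau>)\<^sup>2) + (x - \<tau>) * (1 + (x + \<tau>)\<^sup>2)) / ?P"
    unfolding D'_def by (simp add: one_plus_square_neq add_divide_eq_iff divide_add_eq_iff)
  also have "\<dots> = \<tau> * (2 * (x\<^sup>2 - \<tau>\<^sup>2 - 1)) / ?P"
    by (simp add: power2_eq_square algebra_simps)
  finally have D': "D' = \<tau> * (2 * (x\<^sup>2 - \<tau>\<^sup>2 - 1)) / ?P" .
  have "- 1 / ?A * (2 * (?A + \<tau>\<^sup>2) / ?P) + x / ?A * (2 * x * (?A - \<tau>\<^sup>2) / ?P) =
      (- 1 * (2 * (?A + \<tau>\<^sup>2)) + x * (2 * x * (?A - \<tau>\<^sup>2))) / (?A * ?P)"
    by (simp only: times_divide_times_eq add_divide_distrib)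
  also have "- 1 * (2 * (?A + \<tau>\<^sup>2)) + x * (2 * x * (?A - \<tau>\<^sup>2)) = ?A * (2 * (x\<^sup>2 - \<tau>\<^sup>2 - 1))"
    by (simp add: power2_eq_square algebra_simps)
  also have "\<dots> / (?A * ?P) = D' / \<tau>"
    unfolding D' using \<open>0 < \<tau>\<close> one_plus_square_neq[of x] by simp
  finally have "- 1 / ?A * (2 * (?A + \<tau>\<^sup>2) / ?P) + x / ?A * (2 * x * (?A - \<tau>\<^sup>2) / ?P) = D' / \<tau>" .
  moreover have "(?F has_real_derivative - 1 / ?A * (2 * (?A + \<tau>\<^sup>2) / ?P) + x / ?A * (2 * x * (?A - \<tau>\<^sup>2) / ?P)
      - (D' * \<tau> - sdiff barrier_log x \<tau> * 1) / (\<tau> * \<tau>)) (at \<tau>)"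
    by (intro DERIV_diff DERIV_add DERIV_cmult arctan_part_deriv log_part_deriv *)
  ultimately show "(?F has_real_derivative sdiff barrier_log x \<tau> / \<tau>\<^sup>2) (at \<tau>)"
    using \<open>0 < \<tau>\<close> by (simp add: power2_eq_square diff_divide_distrib)
next
  show "((\<lambda>\<tau>. - 1 / (1 + x\<^sup>2) * arctan_part x \<tau> + x / (1 + x\<^sup>2) * log_part x \<tau> - sdiff barrier_log x \<tau> / \<tau>) \<longlongrightarrow> 0) (at_right 0)"
    using tendsto_diff[OF tendsto_add[OF tendsto_mult_left[OF arctan_part_limits(1)]
          tendsto_mult_left[OF log_part_limits(1)]] sdiff_over_tendsto_0[OF admissible_log]]
    by (simp only: mult_zero_right add_0_right diff_0_right)
  have "((\<lambda>\<tau>. sdiff barrier_log x \<tau> / \<tau>) \<longlongrightarrow> 0) at_top"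
    unfolding sdiff_def barrier_log_def by real_asymp
  then show "((\<lambda>\<tau>. - 1 / (1 + x\<^sup>2) * arctan_part x \<tau> + x / (1 + x\<^sup>2) * log_part x \<tau> - sdiff barrier_log x \<tau> / \<tau>) \<longlongrightarrow>
      - pi / (1 + x\<^sup>2)) at_top"
    using tendsto_diff[OF tendsto_add[OF tendsto_mult_left[OF arctan_part_limits(2), of "- 1 / (1 + x\<^sup>2)"]
          tendsto_mult_left[OF log_part_limits(2), of "x / (1 + x\<^sup>2)"]]]
    by fastforce
qed

text \<open>At $s=1/2$ the operator applied to \<open>barrier_log\<close> is negative but of order $x^{-2}$, the same
  as its positive value on \<open>barrier_bump\<close>; the factor 4 makes the sum positive for $|x|\ge2$ and all
  $s$ in question.\<close>

definition barrier :: "real \<Rightarrow> real" where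
  "barrier x = barrier_log x + 4 * barrier_bump x"

section \<open>Positivity of the barrier off a bounded set\<close>

lemma sdiff_barrier: "sdiff barrier x \<tau> = sdiff barrier_log x \<tau> + 4 * sdiff barrier_bump x \<tau>"
  by (simp add: sdiff_def barrier_def)

lemma barrier_integrable:
  assumes "1/2 \<le> s" "s < 1"
  shows "set_integrable lebesgue {0<..} (\<lambda>\<tau>. sdiff barrier x \<tau> / \<tau> powr (1 + 2 * s))"
  using set_integral_add(1)[OF admissible_integrable[OF admissible_log assms]
      set_integrable_mult_right[OF admissible_integrable[OF admissible_bump assms], of 4]]
  by (simp add: sdiff_barrier add_divide_distrib)

lemma frac_lap_barrier:
  assumes "1/2 \<le> s" "s < 1"
  shows "frac_lap s barrier x = frac_lap s barrier_log x + 4 * frac_lap s barrier_bump x"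
  using set_integral_add(2)[OF admissible_integrable[OF admissible_log assms]
      set_integrable_mult_right[OF admissible_integrable[OF admissible_bump assms], of 4], of x x]
  unfolding set_integral_mult_right frac_lap_def[symmetric]
  by (simp add: frac_lap_def sdiff_barrier add_divide_distrib)

text \<open>Each profile is compared with \<open>s = 1/2\<close> at its own radius of sign change,
  so the comparison factors differ. The bump loses at most a factor 2 against the logarithm; its
  weight 4 thus leaves a factor 2, which wins once \<open>1 + x\<^sup>2\<close> exceeds 4.\<close>

lemma frac_lap_barrier_pos:
  assumes s: "1/2 \<le> s" "s < 1" and x: "2 \<le> \<bar>x\<bar>"
  shows "0 < frac_lap s barrier x"
proof -
  have x2: "4 \<le> x\<^sup>2" using x power_mono[of 2 "\<bar>x\<bar>" 2] by simp
  define A where "A = 1 + x\<^sup>2"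
  have A: "5 \<le> A" using x2 by (simp add: A_def)
  define q where "q = sqrt (2 * (x\<^sup>2 - 1)) powr (1 - 2 * s)"
  have "0 < q" using x2 by (simp add: q_def)
  have log: "q * frac_lap (1/2) barrier_log x \<le> frac_lap s barrier_log x"
    unfolding q_def
  proof (rule frac_lap_ge_of_sign_change[OF admissible_log s])
    fix \<tau> :: real
    have pos: "0 < (1 + x\<^sup>2)\<^sup>2 + \<tau>\<^sup>2 * (\<tau>\<^sup>2 - 2 * (x\<^sup>2 - 1))"
      unfolding shifted_product[symmetric] by (simp add: one_plus_square_pos)
    { assume "0 < \<tau>" "\<tau> \<le> sqrt (2 * (x\<^sup>2 - 1))"
      then have "\<tau>\<^sup>2 \<le> 2 * (x\<^sup>2 - 1)" using x2 power_mono[of \<tau> "sqrt (2 * (x\<^sup>2 - 1))" 2] by simp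
      then have "\<tau>\<^sup>2 * (\<tau>\<^sup>2 - 2 * (x\<^sup>2 - 1)) \<le> 0" by (simp add: mult_nonneg_nonpos)
      with pos show "0 \<le> sdiff barrier_log x \<tau>"
        unfolding sdiff_barrier_log using one_plus_square_pos[of x] by simp }
    { assume "sqrt (2 * (x\<^sup>2 - 1)) \<le> \<tau>"
      then have "2 * (x\<^sup>2 - 1) \<le> \<tau>\<^sup>2" by (rule sqrt_le_D)
      then have "0 \<le> \<tau>\<^sup>2 * (\<tau>\<^sup>2 - 2 * (x\<^sup>2 - 1))" by simp
      with pos show "sdiff barrier_log x \<tau> \<le> 0"
        unfolding sdiff_barrier_log using one_plus_square_pos[of x] by simp }
  qed (use x2 in simp)
  have bump: "sqrt (3 * x\<^sup>2 - 1) powr (1 - 2 * s) * frac_lap (1/2) barrier_bump x \<le> frac_lap s barrier_bump x"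
  proof (rule frac_lap_ge_of_sign_change[OF admissible_bump s])
    fix \<tau> :: real
    have pos: "0 < (1 + x\<^sup>2) * ((1 + (x + \<tau>)\<^sup>2) * (1 + (x - \<tau>)\<^sup>2))"
      by (simp add: one_plus_square_pos)
    { assume "0 < \<tau>" "\<tau> \<le> sqrt (3 * x\<^sup>2 - 1)"
      then have "\<tau>\<^sup>2 \<le> 3 * x\<^sup>2 - 1" using x2 power_mono[of \<tau> "sqrt (3 * x\<^sup>2 - 1)" 2] by simp
      with pos show "0 \<le> sdiff barrier_bump x \<tau>" unfolding sdiff_barrier_bump
        by (intro divide_nonneg_pos mult_nonneg_nonneg) auto }
    { assume "sqrt (3 * x\<^sup>2 - 1) \<le> \<tau>"
      then have "3 * x\<^sup>2 - 1 \<le> \<tau>\<^sup>2" by (rule sqrt_le_D)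
      with pos show "sdiff barrier_bump x \<tau> \<le> 0" unfolding sdiff_barrier_bump
        by (intro divide_nonpos_pos mult_nonneg_nonpos) auto }
  qed (use x2 in simp)
  \<comment> \<open>The radius for the bump is at most twice the one for the logarithm, and
    \<open>1 - 2 * s\<close> is at least -1, so the factor drops by at most one half.\<close>
  have "q / 2 \<le> sqrt (3 * x\<^sup>2 - 1) powr (1 - 2 * s)"
  proof -
    have "sqrt (3 * x\<^sup>2 - 1) \<le> sqrt (4 * (2 * (x\<^sup>2 - 1)))" using x2 by simp
    also have "\<dots> = 2 * sqrt (2 * (x\<^sup>2 - 1))" by (simp only: real_sqrt_mult real_sqrt_four)
    finally have "(2 * sqrt (2 * (x\<^sup>2 - 1))) powr (1 - 2 * s) \<le> sqrt (3 * x\<^sup>2 - 1) powr (1 - 2 * s)"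
      using s x2 by (intro powr_mono2') auto
    moreover have "(2 * sqrt (2 * (x\<^sup>2 - 1))) powr (1 - 2 * s) = 2 powr (1 - 2 * s) * q"
      using x2 by (simp add: q_def powr_mult)
    moreover have "1 / 2 \<le> 2 powr (1 - 2 * s)"
      using powr_mono[of "-1" "1 - 2 * s" 2] s by (simp add: powr_minus_divide)
    ultimately show ?thesis
      using \<open>0 < q\<close> mult_right_mono[of "1/2" "2 powr (1 - 2 * s)" q] by linarith
  qed
  moreover have half_bump: "frac_lap (1/2) barrier_bump x = (A - 2) / A\<^sup>2 * pi"
    by (simp add: frac_lap_half_barrier_bump A_def)
  moreover have "0 \<le> (A - 2) / A\<^sup>2 * pi" using A by simp
  ultimately have "q / 2 * ((A - 2) / A\<^sup>2 * pi) \<le> frac_lap s barrier_bump x"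
    using bump mult_right_mono[of "q / 2" _ "(A - 2) / A\<^sup>2 * pi"] by fastforce
  moreover have "- (q * (pi / A)) \<le> frac_lap s barrier_log x"
    using log by (simp add: frac_lap_half_barrier_log A_def)
  moreover have "- (q * (pi / A)) + 4 * (q / 2 * ((A - 2) / A\<^sup>2 * pi)) = q * pi * ((A - 4) / A\<^sup>2)"
    using A by (simp add: field_simps power2_eq_square)
  moreover have "0 < q * pi * ((A - 4) / A\<^sup>2)" using A \<open>0 < q\<close> by simp
  ultimately show ?thesis unfolding frac_lap_barrier[OF s] by linarith
qed

section \<open>Tools for the contact argument: minima, dilations, one direction\<close>

text \<open>If every \<open>x\<close> had a better point \<open>m x\<close>, semicontinuity would
  keep \<open>f\<close> above \<open>f (m x)\<close> near \<open>x\<close>. Among the finitely many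
  \<open>m x\<close> of a subcover, the best one lies in some \<open>U y\<close>, where
  \<open>f\<close> exceeds \<open>f (m y)\<close>: a contradiction.\<close>

lemma compact_attains_min_lsc:
  fixes f :: "'a::topological_space \<Rightarrow> real"
  assumes "compact K" "K \<noteq> {}"
    and lsc: "\<And>x y. x \<in> K \<Longrightarrow> y < f x \<Longrightarrow> eventually (\<lambda>z. y < f z) (nhds x)"
  shows "\<exists>x\<in>K. \<forall>y\<in>K. f x \<le> f y"
proof (rule ccontr)
  assume "\<not> ?thesis"
  then have "\<forall>x\<in>K. \<exists>y\<in>K. f y < f x" by (meson not_le)
  then obtain m where m: "\<And>x. x \<in> K \<Longrightarrow> m x \<in> K \<and> f (m x) < f x" by metis
  have "\<exists>U. open U \<and> x \<in> U \<and> (\<forall>z\<in>U. f (m x) < f z)" if "x \<in> K" for x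
    using lsc[OF that, of "f (m x)"] m[OF that] by (auto simp: eventually_nhds)
  then obtain U where U: "\<And>x. x \<in> K \<Longrightarrow> open (U x) \<and> x \<in> U x \<and> (\<forall>z\<in>U x. f (m x) < f z)"
    by metis
  from compactE_image[OF \<open>compact K\<close>, of K U] U
  obtain K' where K': "K' \<subseteq> K" "finite K'" "K \<subseteq> (\<Union>x\<in>K'. U x)" by blast
  then have "K' \<noteq> {}" using \<open>K \<noteq> {}\<close> by auto
  define x where "x = arg_min_on (f \<circ> m) K'"
  have x: "x \<in> K'" "\<And>y. y \<in> K' \<Longrightarrow> f (m x) \<le> f (m y)"
    using arg_min_if_finite[OF K'(2) \<open>K' \<noteq> {}\<close>, of "f \<circ> m"] unfolding x_def by (auto simp: not_less)
  then have "m x \<in> K" using m K' by blast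
  then obtain y where "y \<in> K'" "m x \<in> U y" using K' by blast
  then have "f (m y) < f (m x)" using U K' by blast
  with x(2)[OF \<open>y \<in> K'\<close>] show False by simp
qed

text \<open>Substituting \<open>l * \<tau>\<close> gives \<open>l powr (1 + 2 * s)\<close> from the
  kernel and \<open>1 / l\<close> from the measure.\<close>

lemma frac_lap_rescale:
  assumes "0 < l"
  shows "frac_lap s (\<lambda>t. d * f (l * t)) t = d * l powr (2 * s) * frac_lap s f (l * t)" (is ?eq)
    and "set_integrable lebesgue {0<..} (\<lambda>\<tau>. sdiff f (l * t) \<tau> / \<tau> powr (1 + 2 * s)) \<Longrightarrow>
      set_integrable lebesgue {0<..} (\<lambda>\<tau>. sdiff (\<lambda>t. d * f (l * t)) t \<tau> / \<tau> powr (1 + 2 * s))"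
proof -
  let ?g = "\<lambda>\<tau>. indicator {0<..} \<tau> *\<^sub>R (sdiff f (l * t) \<tau> / \<tau> powr (1 + 2 * s))"
  \<comment> \<open>The summand 0 gives the argument the affine shape of the substitution
    rule.\<close>
  have *: "indicator {0<..} \<tau> *\<^sub>R (sdiff (\<lambda>t. d * f (l * t)) t \<tau> / \<tau> powr (1 + 2 * s)) =
      d * l powr (1 + 2 * s) * ?g (0 + l * \<tau>)" for \<tau>
  proof (cases "0 < \<tau>")
    case True
    have "(l * \<tau>) powr (1 + 2 * s) = l powr (1 + 2 * s) * \<tau> powr (1 + 2 * s)"
      using True \<open>0 < l\<close> by (simp only: powr_mult)
    moreover have "l powr (1 + 2 * s) \<noteq> 0" using \<open>0 < l\<close> by simp
    moreover have "sdiff (\<lambda>t. d * f (l * t)) t \<tau> = d * sdiff f (l * t) (l * \<tau>)"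
      by (simp add: sdiff_def algebra_simps)
    ultimately show ?thesis using True \<open>0 < l\<close> by (simp add: zero_less_mult_iff)
  next
    case False
    then show ?thesis using \<open>0 < l\<close> by (simp add: zero_less_mult_iff)
  qed
  have "frac_lap s (\<lambda>t. d * f (l * t)) t = d * l powr (1 + 2 * s) * (\<integral>\<tau>. ?g (0 + l * \<tau>) \<partial>lebesgue)"
    unfolding frac_lap_def set_lebesgue_integral_def * by (rule integral_mult_right_zero)
  also have "(\<integral>\<tau>. ?g (0 + l * \<tau>) \<partial>lebesgue) = frac_lap s f (l * t) / l"
    using lebesgue_integral_real_affine[of l ?g 0] \<open>0 < l\<close>
    by (simp add: frac_lap_def set_lebesgue_integral_def)
  finally show ?eq using \<open>0 < l\<close> by (simp add: powr_add)
  assume "set_integrable lebesgue {0<..} (\<lambda>\<tau>. sdiff f (l * t) \<tau> / \<tau> powr (1 + 2 * s))"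
  then have "integrable lebesgue (\<lambda>\<tau>. ?g (0 + l * \<tau>))"
    using lebesgue_integrable_real_affine_iff[of l ?g 0] \<open>0 < l\<close> by (simp add: set_integrable_def)
  then show "set_integrable lebesgue {0<..} (\<lambda>\<tau>. sdiff (\<lambda>t. d * f (l * t)) t \<tau> / \<tau> powr (1 + 2 * s))"
    unfolding set_integrable_def * by (rule integrable_mult_right)
qed

text \<open>The value of the test function \<open>\<phi>\<close> enters only through one direction \<open>e\<close>: the supremum is
  at least the integral in that direction, and this one is at least the integral of \<open>\<phi>\<close>.\<close>

lemma visc_supersol_one_direction:
  fixes u \<phi> :: "real ^ 'n::finite \<Rightarrow> real" and x e :: "real ^ 'n"
  assumes sup: "visc_supersol s \<Omega> (I1_plus C s) f u" and "0 < C s" and s: "s < 1"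
    and nonneg: "\<And>z. 0 \<le> u z"
    and x: "x \<in> \<Omega>" and r: "0 < r" "ball x r \<subseteq> \<Omega>"
    and C2: "C2_closure (ball x r) \<phi>" and cont: "continuous_on UNIV \<phi>"
    and touch: "\<phi> x = u x" "\<And>z. \<phi> z \<le> u z"
    and K: "0 \<le> K" "\<And>\<xi> \<tau>. norm \<xi> = 1 \<Longrightarrow> 0 < \<tau> \<Longrightarrow> \<phi> (x + \<tau> *\<^sub>R \<xi>) + \<phi> (x - \<tau> *\<^sub>R \<xi>) - 2 * \<phi> x \<le> K * \<tau>\<^sup>2"
    and e: "norm e = 1" "\<And>\<tau>. 0 < \<tau> \<Longrightarrow> sdiff F t \<tau> = \<phi> (x + \<tau> *\<^sub>R e) + \<phi> (x - \<tau> *\<^sub>R e) - 2 * \<phi> x"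
    and int: "set_integrable lebesgue {0<..} (\<lambda>\<tau>. sdiff F t \<tau> / \<tau> powr (1 + 2 * s))"
  shows "C s * frac_lap s F t + f x (u x) \<le> 0"
proof -
  define \<psi> where "\<psi> = (\<lambda>z. if z \<in> ball x r then \<phi> z else u z)"
  have "u \<in> S_space s \<Omega>" using sup by (simp add: visc_supersol_def)
  then obtain \<alpha> D where \<alpha>: "0 \<le> \<alpha>" "\<alpha> < 2 * s" "0 < D" "\<And>z. \<bar>u z\<bar> \<le> D * (1 + norm z) powr \<alpha>"
    and meas: "\<And>\<xi>. norm \<xi> = 1 \<Longrightarrow> (\<lambda>\<tau>. u (x + \<tau> *\<^sub>R \<xi>)) \<in> borel_measurable lebesgue"
    using x by (auto simp: S_space_def)
  \<comment> \<open>Chosen so that \<open>(B - 1) * r = 1 + norm x\<close>; then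
    \<open>1 + norm (x + \<tau> *\<^sub>R \<xi>)\<close> is at most
    \<open>B * \<bar>\<tau>\<bar>\<close> as soon as \<bar>\<tau>\<bar> is at least
    \<open>r\<close>.\<close>
  define B where "B = (1 + norm x) / r + 1"
  define K' where "K' = K + 2 * D * B powr \<alpha>"
  define g where "g = (\<lambda>\<tau>. K' * kernel_bound s \<alpha> r \<tau>)"
  have K': "0 \<le> K'" "K \<le> K'" "2 * D * B powr \<alpha> \<le> K'" using K \<alpha> by (auto simp: K'_def)
  have g_int: "set_integrable lebesgue {0<..} g"
    unfolding g_def using s \<alpha> r by (intro set_integrable_mult_right set_integrable_kernel_bound)
  have \<psi>x: "\<psi> x = u x" using r touch by (simp add: \<psi>_def)
  have far: "\<psi> (x + \<tau> *\<^sub>R \<xi>) \<le> D * B powr \<alpha> * \<bar>\<tau>\<bar> powr \<alpha>" if "norm \<xi> = 1" "r \<le> \<bar>\<tau>\<bar>" for \<tau> \<xi>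
  proof -
    have "\<psi> (x + \<tau> *\<^sub>R \<xi>) = u (x + \<tau> *\<^sub>R \<xi>)" using that by (simp add: \<psi>_def dist_norm)
    also have "\<dots> \<le> D * (1 + norm (x + \<tau> *\<^sub>R \<xi>)) powr \<alpha>" using \<alpha>(4)[of "x + \<tau> *\<^sub>R \<xi>"] by simp
    also have "\<dots> \<le> D * (B * \<bar>\<tau>\<bar>) powr \<alpha>"
    proof (intro mult_left_mono powr_mono2)
      have "(B - 1) * r \<le> (B - 1) * \<bar>\<tau>\<bar>"
        using that r by (intro mult_left_mono) (auto simp: B_def)
      moreover have "(B - 1) * r = 1 + norm x" using r by (simp add: B_def)
      moreover have "norm (x + \<tau> *\<^sub>R \<xi>) \<le> norm x + \<bar>\<tau>\<bar>"
        using norm_triangle_ineq[of x "\<tau> *\<^sub>R \<xi>"] that by simp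
      ultimately show "1 + norm (x + \<tau> *\<^sub>R \<xi>) \<le> B * \<bar>\<tau>\<bar>"
        by (simp add: left_diff_distrib)
    qed (use \<alpha> in auto)
    also have "\<dots> = D * B powr \<alpha> * \<bar>\<tau>\<bar> powr \<alpha>"
      using r by (simp add: powr_mult B_def)
    finally show ?thesis .
  qed
  have upper: "(\<psi> (x + \<tau> *\<^sub>R \<xi>) + \<psi> (x - \<tau> *\<^sub>R \<xi>) - 2 * \<psi> x) / \<tau> powr (1 + 2 * s) \<le> g \<tau>"
    if "norm \<xi> = 1" "0 < \<tau>" for \<xi> \<tau>
  proof -
    have "\<psi> (x + \<tau> *\<^sub>R \<xi>) + \<psi> (x - \<tau> *\<^sub>R \<xi>) - 2 * \<psi> x \<le> K' * (if \<tau> < r then \<tau>\<^sup>2 else \<tau> powr \<alpha>)"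
    proof (cases "\<tau> < r")
      case True
      then have "\<psi> (x + \<tau> *\<^sub>R \<xi>) + \<psi> (x - \<tau> *\<^sub>R \<xi>) - 2 * \<psi> x \<le> K * \<tau>\<^sup>2"
        using K(2)[OF that] that touch(1) by (simp add: \<psi>x) (simp add: \<psi>_def dist_norm)
      also have "\<dots> \<le> K' * \<tau>\<^sup>2" using K' by (intro mult_right_mono) auto
      finally show ?thesis using True by simp
    next
      case False
      \<comment> \<open>The term \<open>- 2 * \<psi> x\<close> is nonpositive because
        \<open>u\<close> is nonnegative, and is dropped.\<close>
      have "\<psi> (x + \<tau> *\<^sub>R \<xi>) + \<psi> (x - \<tau> *\<^sub>R \<xi>) - 2 * \<psi> x \<le> (2 * D * B powr \<alpha>) * \<tau> powr \<alpha>"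
        using far[OF that(1), of \<tau>] far[OF that(1), of "- \<tau>"] False that nonneg[of x] by (simp add: \<psi>x)
      also have "\<dots> \<le> K' * \<tau> powr \<alpha>" using K' by (intro mult_right_mono) auto
      finally show ?thesis using False by simp
    qed
    then show ?thesis by (simp add: g_def kernel_bound_def divide_right_mono)
  qed
  \<comment> \<open>The bound does not depend on \<xi>. It makes the set of directional values
    bounded above, so that the real supremum dominates each of them.\<close>
  have I_upper: "I_dir C s \<xi> \<psi> x \<le> C s * (LINT \<tau>:{0<..}|lebesgue. g \<tau>)" if "norm \<xi> = 1" for \<xi>
    unfolding I_dir_def set_lebesgue_integral_def
  proof (intro mult_left_mono integral_mono')
    show "integrable lebesgue (\<lambda>\<tau>. indicator {0<..} \<tau> *\<^sub>R g \<tau>)" using g_int by (simp add: set_integrable_def)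
    show "indicator {0<..} \<tau> *\<^sub>R ((\<psi> (x + \<tau> *\<^sub>R \<xi>) + \<psi> (x - \<tau> *\<^sub>R \<xi>) - 2 * \<psi> x) / \<tau> powr (1 + 2 * s)) \<le>
        indicator {0<..} \<tau> *\<^sub>R g \<tau>" for \<tau>
      using upper[OF that, of \<tau>] by (simp add: indicator_def)
    \<comment> \<open>No lower bound is at hand for a general direction, so the smaller integrand
      need not be shown integrable; nonnegativity of \<open>g\<close> covers the default value 0 of
      its integral.\<close>
    show "0 \<le> indicator {0<..} \<tau> *\<^sub>R g \<tau>" for \<tau>
      using K' by (simp add: g_def kernel_bound_nonneg)
  qed (use \<open>0 < C s\<close> in simp)
  have "I_dir C s e \<psi> x \<le> I1_plus C s \<psi> x"
    unfolding I1_plus_def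
  proof (rule cSUP_upper)
    show "bdd_above ((\<lambda>\<xi>. I_dir C s \<xi> \<psi> x) ` {\<xi>. norm \<xi> = 1})"
      using I_upper by (intro bdd_aboveI) auto
  qed (use e in simp)
  moreover have "I1_plus C s \<psi> x + f x (u x) \<le> 0"
    using sup x r C2 touch unfolding visc_supersol_def \<psi>_def by blast
  moreover have "C s * frac_lap s F t \<le> I_dir C s e \<psi> x"
  proof -
    let ?h = "\<lambda>\<tau>. (\<psi> (x + \<tau> *\<^sub>R e) + \<psi> (x - \<tau> *\<^sub>R e) - 2 * \<psi> x) / \<tau> powr (1 + 2 * s)"
    have lower: "sdiff F t \<tau> / \<tau> powr (1 + 2 * s) \<le> ?h \<tau>" if "0 < \<tau>" for \<tau>
    proof -
      have "\<phi> z \<le> \<psi> z" for z using touch(2) by (simp add: \<psi>_def)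
      from add_mono[OF this[of "x + \<tau> *\<^sub>R e"] this[of "x - \<tau> *\<^sub>R e"]]
      have "sdiff F t \<tau> \<le> \<psi> (x + \<tau> *\<^sub>R e) + \<psi> (x - \<tau> *\<^sub>R e) - 2 * \<psi> x"
        unfolding e(2)[OF that] using touch(1) \<psi>x by simp
      then show ?thesis by (rule divide_right_mono) simp
    qed
    have \<psi>_meas: "(\<lambda>\<tau>. \<psi> (x + \<tau> *\<^sub>R \<xi>)) \<in> borel_measurable lebesgue" if "norm \<xi> = 1" for \<xi>
    proof -
      have "continuous_on UNIV (\<lambda>\<tau>. \<phi> (x + \<tau> *\<^sub>R \<xi>))"
        by (intro continuous_on_compose2[OF cont] continuous_intros) auto
      then have "(\<lambda>\<tau>. \<phi> (x + \<tau> *\<^sub>R \<xi>)) \<in> borel_measurable lebesgue"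
        by (intro measurable_completion) (simp add: borel_measurable_continuous_onI)
      moreover have "(\<lambda>\<tau>. \<psi> (x + \<tau> *\<^sub>R \<xi>)) = (\<lambda>\<tau>. if \<tau> \<in> {-r<..<r} then \<phi> (x + \<tau> *\<^sub>R \<xi>) else u (x + \<tau> *\<^sub>R \<xi>))"
        using that by (auto simp: \<psi>_def dist_norm fun_eq_iff)
      ultimately show ?thesis using meas[OF that]
        by (simp only:) (rule measurable_If_set; simp)
    qed
    have "(\<lambda>\<tau>. \<tau> powr (1 + 2 * s)) \<in> borel_measurable lebesgue"
      by (intro measurable_completion) measurable
    then have h_meas: "?h \<in> borel_measurable lebesgue"
      using \<psi>_meas[OF e(1)] \<psi>_meas[of "- e"] e(1) by simp
    \<comment> \<open>In the direction \<open>e\<close> there are bounds from both sides: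
      \<open>lower\<close> from the profile and \<open>upper\<close> from \<open>g\<close>.\<close>
    have h_int: "set_integrable lebesgue {0<..} ?h"
    proof (rule set_integrable_bounded_by[OF _ _ h_meas])
      show "set_integrable lebesgue {0<..} (\<lambda>\<tau>. \<bar>sdiff F t \<tau> / \<tau> powr (1 + 2 * s)\<bar> + \<bar>g \<tau>\<bar>)"
        by (intro set_integral_add set_integrable_abs int g_int)
      show "\<bar>?h \<tau>\<bar> \<le> \<bar>sdiff F t \<tau> / \<tau> powr (1 + 2 * s)\<bar> + \<bar>g \<tau>\<bar>" if "\<tau> \<in> {0<..}" for \<tau>
      proof -
        have "0 < \<tau>" using that by simp
        from lower[OF this] upper[OF e(1) this] show ?thesis by linarith
      qed
    qed simp
    have "frac_lap s F t \<le> (LINT \<tau>:{0<..}|lebesgue. ?h \<tau>)"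
      unfolding frac_lap_def using lower by (intro set_integral_mono int h_int) auto
    then show ?thesis unfolding I_dir_def using \<open>0 < C s\<close> by (intro mult_left_mono) auto
  qed
  ultimately show ?thesis by linarith
qed

section \<open>Regularity of the barrier and of ridge functions\<close>

lemma barrier_derivs:
  obtains b b' where "\<And>x. (barrier has_real_derivative b x) (at x)"
    "\<And>x. (b has_real_derivative b' x) (at x)" "continuous_on UNIV b'" "\<And>x. \<bar>b' x\<bar> \<le> 30"
proof
  let ?l = "\<lambda>x::real. (x\<^sup>2 - 1) / (1 + x\<^sup>2)\<^sup>2"
  let ?m = "\<lambda>x::real. (6 * x\<^sup>2 - 2) / (1 + x\<^sup>2) ^ 3"
  note c = admissible_log[unfolded admissible_def] admissible_bump[unfolded admissible_def]
  fix x :: real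
  show "(barrier has_real_derivative - x / (1 + x\<^sup>2) + 4 * (- 2 * x / (1 + x\<^sup>2)\<^sup>2)) (at x)"
    unfolding barrier_def[abs_def] using c by (intro DERIV_add DERIV_cmult) auto
  show "((\<lambda>x. - x / (1 + x\<^sup>2) + 4 * (- 2 * x / (1 + x\<^sup>2)\<^sup>2)) has_real_derivative ?l x + 4 * ?m x) (at x)"
    using c by (intro DERIV_add DERIV_cmult) auto
  show "continuous_on UNIV (\<lambda>x. ?l x + 4 * ?m x)"
    by (intro continuous_intros) (auto simp: one_plus_square_neq)
  have "\<bar>?l x\<bar> \<le> 6" "\<bar>?m x\<bar> \<le> 6" using c by blast+
  then show "\<bar>?l x + 4 * ?m x\<bar> \<le> 30" by linarith
qed

lemma barrier_le_4: "barrier x \<le> 4"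
proof -
  have "0 \<le> ln (1 + x\<^sup>2)" by simp
  moreover have "1 / (1 + x\<^sup>2) \<le> 1" by (simp add: divide_le_eq one_plus_square_pos)
  ultimately show ?thesis unfolding barrier_def barrier_log_def barrier_bump_def by linarith
qed

lemma barrier_0: "barrier 0 = 4"
  by (simp add: barrier_def barrier_log_def barrier_bump_def)

lemma barrier_abs: "barrier \<bar>x\<bar> = barrier x"
  by (simp add: barrier_def barrier_log_def barrier_bump_def)

lemma barrier_unbounded: "\<exists>R\<ge>0. \<forall>x. R < \<bar>x\<bar> \<longrightarrow> barrier x < y"
proof -
  have "filterlim barrier at_bot at_top"
    unfolding barrier_def[abs_def] barrier_log_def barrier_bump_def by real_asymp
  then have "eventually (\<lambda>x. barrier x < y) at_top" by (rule filterlim_at_bot_dense[THEN iffD1, rule_format])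
  then obtain R where R: "\<And>x. R \<le> x \<Longrightarrow> barrier x < y" by (auto simp: eventually_at_top_linorder)
  have "barrier x < y" if "max R 0 < \<bar>x\<bar>" for x
    using R[of "\<bar>x\<bar>"] that by (simp add: barrier_abs)
  then show ?thesis by (intro exI[of _ "max R 0"]) auto
qed

text \<open>The factor of \<open>M\<close> is the squared distance to the line through
  \<open>x0\<close> parallel to axis \<open>j\<close>.\<close>

definition ridge :: "'n \<Rightarrow> real ^ 'n \<Rightarrow> real \<Rightarrow> (real \<Rightarrow> real) \<Rightarrow> real ^ 'n::finite \<Rightarrow> real" where
  "ridge j x0 M F x = F ((x - x0) $ j) - M * (norm (x - x0) ^ 2 - ((x - x0) $ j)\<^sup>2)"

lemma C2_closure_ridge:
  fixes x0 :: "real ^ 'n::finite"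
  assumes F: "\<And>t. (F has_real_derivative F' t) (at t)"
    and F': "\<And>t. (F' has_real_derivative F'' t) (at t)"
    and F'': "continuous_on UNIV F''"
  shows "C2_closure B (ridge j x0 M F)"
proof -
  \<comment> \<open>The ridge equals \<open>F t + M * t\<^sup>2 - M * norm (x - x0) ^ 2\<close> with
    \<open>t\<close> the \<open>j\<close>-th coordinate of \<open>x - x0\<close>; \<open>G'\<close>
    differentiates the part depending on \<open>t\<close>.\<close>
  define G' where "G' = (\<lambda>t. F' t + 2 * M * t)"
  define G'' where "G'' = (\<lambda>t. F'' t + 2 * M)"
  \<comment> \<open>The matrix unit at (j, j), which is the Hessian of
    \<open>t\<^sup>2 / 2\<close>.\<close>
  define E :: "real ^ 'n ^ 'n" where "E = (\<chi> i. if i = j then axis j 1 else 0)"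
  have E: "E *v h = h $ j *\<^sub>R axis j 1" for h
  proof -
    have "(E *v h) $ i = (if i = j then h $ j else 0)" for i
      by (simp add: matrix_vector_mul_component E_def inner_axis')
    then show ?thesis by (simp add: vec_eq_iff axis_def)
  qed
  have d: "((\<lambda>x. (x - x0) $ j) has_derivative (\<lambda>h. h $ j)) (at x)" for x
    using bounded_linear.has_derivative[OF bounded_linear_vec_nth
        has_derivative_diff[OF has_derivative_ident has_derivative_const]] by simp
  have fd: "((\<lambda>x. f ((x - x0) $ j)) has_derivative (\<lambda>h. f' ((x - x0) $ j) * h $ j)) (at x)"
    if "\<And>t. (f has_real_derivative f' t) (at t)" for f f' x
    using has_derivative_compose[OF d that[THEN has_field_derivative_imp_has_derivative]] by simp
  have G': "(G' has_real_derivative G'' t) (at t)" for t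
    unfolding G'_def G''_def by (auto intro!: derivative_eq_intros F')
  let ?g = "\<lambda>x. G' ((x - x0) $ j) *\<^sub>R axis j 1 - (2 * M) *\<^sub>R (x - x0)"
  let ?H = "\<lambda>x. G'' ((x - x0) $ j) *\<^sub>R E - (2 * M) *\<^sub>R mat 1"
  have 1: "(ridge j x0 M F has_derivative (\<lambda>h. ?g x \<bullet> h)) (at x)" for x
  proof -
    have "((\<lambda>x. norm (x - x0) ^ 2) has_derivative (\<lambda>h. 2 * ((x - x0) \<bullet> h))) (at x)"
      unfolding power2_norm_eq_inner
      by (auto intro!: derivative_eq_intros simp: inner_commute)
    moreover have "((\<lambda>x. ((x - x0) $ j)\<^sup>2) has_derivative (\<lambda>h. (2 * (x - x0) $ j) * h $ j)) (at x)"
      by (rule fd[of power2]) (auto intro!: derivative_eq_intros)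
    ultimately have "(ridge j x0 M F has_derivative (\<lambda>h. F' ((x - x0) $ j) * h $ j
        - M * (2 * ((x - x0) \<bullet> h) - (2 * (x - x0) $ j) * h $ j))) (at x)"
      unfolding ridge_def[abs_def]
      by (intro has_derivative_diff fd[OF F] has_derivative_mult_right)
    moreover have "F' ((x - x0) $ j) * h $ j - M * (2 * ((x - x0) \<bullet> h) - (2 * (x - x0) $ j) * h $ j) = ?g x \<bullet> h" for h
      by (simp add: G'_def inner_diff_left inner_add_left inner_axis' algebra_simps)
    ultimately show ?thesis by simp
  qed
  have 2: "(?g has_derivative (\<lambda>h. ?H x *v h)) (at x)" for x
  proof -
    have "(?g has_derivative (\<lambda>h. (G'' ((x - x0) $ j) * h $ j) *\<^sub>R axis j 1 - (2 * M) *\<^sub>R (h - 0))) (at x)"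
      by (intro has_derivative_diff has_derivative_scaleR_left has_derivative_scaleR_right fd[OF G']
          has_derivative_ident has_derivative_const)
    then show ?thesis
      by (simp add: matrix_vector_mult_diff_rdistrib scaleR_matrix_vector_assoc[symmetric] E)
  qed
  have 3: "continuous_on S ?g" for S
    by (intro has_derivative_continuous_on[where f' = "\<lambda>x h. ?H x *v h"] has_derivative_at_withinI[OF 2])
  have 4: "continuous_on S (ridge j x0 M F)" for S
    by (intro has_derivative_continuous_on[where f' = "\<lambda>x h. ?g x \<bullet> h"] has_derivative_at_withinI[OF 1])
  have "continuous_on S ?H" for S
    unfolding G''_def by (intro continuous_intros continuous_on_compose2[OF F'']) auto
  with 1 2 3 4 show ?thesis
    unfolding C2_closure_def C2_with_jet_def by (intro exI[of _ ?g] exI[of _ ?H] conjI ballI)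
qed

text \<open>The penalty is a quadratic form, so its second difference is exact and independent of
  \<open>x\<close>. It vanishes in the direction of axis \<open>j\<close>, and for nonnegative
  \<open>M\<close> it is nonpositive in all others.\<close>

lemma ridge_second_difference:
  fixes x \<xi> :: "real ^ 'n::finite"
  assumes "norm \<xi> = 1"
  shows "ridge j x0 M F (x + \<tau> *\<^sub>R \<xi>) + ridge j x0 M F (x - \<tau> *\<^sub>R \<xi>) - 2 * ridge j x0 M F x =
    sdiff F ((x - x0) $ j) (\<tau> * \<xi> $ j) - 2 * M * \<tau>\<^sup>2 * (1 - (\<xi> $ j)\<^sup>2)"
proof -
  let ?y = "x - x0"
  have "norm (?y + \<tau> *\<^sub>R \<xi>) ^ 2 + norm (?y - \<tau> *\<^sub>R \<xi>) ^ 2 = 2 * norm ?y ^ 2 + 2 * \<tau>\<^sup>2 * (\<xi> \<bullet> \<xi>)"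
    unfolding power2_norm_eq_inner by (simp add: inner_simps power2_eq_square algebra_simps)
  moreover have "\<xi> \<bullet> \<xi> = 1" using assms by (simp flip: power2_norm_eq_inner)
  moreover have "x + \<tau> *\<^sub>R \<xi> - x0 = ?y + \<tau> *\<^sub>R \<xi>" "x - \<tau> *\<^sub>R \<xi> - x0 = ?y - \<tau> *\<^sub>R \<xi>"
    by (simp_all add: algebra_simps)
  ultimately have "norm (x + \<tau> *\<^sub>R \<xi> - x0) ^ 2 + norm (x - \<tau> *\<^sub>R \<xi> - x0) ^ 2 = 2 * norm ?y ^ 2 + 2 * \<tau>\<^sup>2"
    by (simp only: mult_1_right)
  then have n: "norm (x - \<tau> *\<^sub>R \<xi> - x0) ^ 2 = 2 * norm ?y ^ 2 + 2 * \<tau>\<^sup>2 - norm (x + \<tau> *\<^sub>R \<xi> - x0) ^ 2" by simp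
  have c: "(x + \<tau> *\<^sub>R \<xi> - x0) $ j = ?y $ j + \<tau> * \<xi> $ j" "(x - \<tau> *\<^sub>R \<xi> - x0) $ j = ?y $ j - \<tau> * \<xi> $ j"
    by simp_all
  show ?thesis
    unfolding ridge_def n c sdiff_def by (simp add: power2_eq_square algebra_simps)
qed

text \<open>Lets the penalty, which sees everything except coordinate \<open>j\<close>, control the
  displacement in coordinate \<open>k\<close> towards the boundary.\<close>

lemma components_le_norm:
  fixes v :: "real ^ 'n::finite"
  assumes "j \<noteq> k"
  shows "(v $ j)\<^sup>2 + (v $ k)\<^sup>2 \<le> norm v ^ 2"
proof -
  have "(\<Sum>i\<in>{j, k}. (v $ i)\<^sup>2) \<le> (\<Sum>i\<in>UNIV. (v $ i)\<^sup>2)"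
    by (rule sum_mono2) auto
  then show ?thesis
    using assms by (simp add: norm_vec_def L2_set_def sum_nonneg)
qed

section \<open>The contact point and the contradiction\<close>

theorem theorem1p2:
  fixes k :: "'n::finite" and C :: "real \<Rightarrow> real" and s p :: real and u :: "real ^ 'n \<Rightarrow> real"
  assumes "CARD('n) \<ge> 2"
    and "normalizing_constant TYPE('n) C"
    and "1 / 2 \<le> s" and "s < 1"
    and "u \<in> LSC (half_space k) \<inter> S_space s (half_space k)"
    and "\<And>x. 0 \<le> u x"
    and "visc_supersol_Dirichlet s (half_space k) (I1_plus C s) (\<lambda>x t. t powr p) u"
    and "0 < p" and "p < 1 / (1 - s)"
  shows "\<forall>x\<in>half_space k. u x = 0"
proof (intro ballI, rule ccontr)
  fix x0 :: "real ^ 'n" assume x0: "x0 \<in> half_space k" and "u x0 \<noteq> 0"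
  define a where "a = u x0"
  have "0 < a" using \<open>u x0 \<noteq> 0\<close> assms(6)[of x0] by (simp add: a_def)
  have "0 < C s" using assms(2-4) by (simp add: normalizing_constant_def)
  \<comment> \<open>Dimension at least two provides a coordinate axis parallel to the
    boundary.\<close>
  have "\<exists>j. j \<noteq> k"
  proof (rule ccontr)
    assume "\<not> ?thesis"
    then have "(UNIV :: 'n set) = {k}" by auto
    then have "CARD('n) = card {k}" by (simp only:)
    with assms(1) show False by simp
  qed
  then obtain j where j: "j \<noteq> k" by blast
  have open_hs: "open (half_space k)"
    unfolding half_space_def by (intro open_Collect_less continuous_intros)
  have lsc: "eventually (\<lambda>z. y < u z) (nhds x)" if "x \<in> half_space k" "y < u x" for x y
  proof -
    have "eventually (\<lambda>z. y < u z) (at x)"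
      using assms(5) that open_hs by (auto simp: LSC_def at_within_open[OF _ open_hs])
    then show ?thesis using that by (auto simp: eventually_nhds_conv_at)
  qed
  have "eventually (\<lambda>z. a / 2 < u z \<and> z \<in> half_space k) (nhds x0)"
    using lsc[OF x0, of "a / 2"] \<open>0 < a\<close> eventually_nhds_in_open[OF open_hs x0]
    by (auto simp: a_def eventually_conj_iff)
  then obtain \<rho> where \<rho>: "0 < \<rho>" "\<And>z. dist z x0 < \<rho> \<Longrightarrow> a / 2 < u z \<and> z \<in> half_space k"
    unfolding eventually_nhds_metric by blast
  \<comment> \<open>As \<open>l = 2 / \<eta>\<close>, the condition
    \<open>\<bar>l * t\<bar> < 2\<close> means \<open>\<bar>t\<bar> < \<eta>\<close>; an orthogonal
    part of length at most \<eta> then keeps the point in the ball of radius \<rho>, since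
    \<open>2 * \<eta>\<^sup>2 \<le> \<rho>\<^sup>2\<close>. \<open>M\<close> makes the penalty at
    distance \<eta> equal to \<open>a + 1\<close>.\<close>
  define \<eta> where "\<eta> = \<rho> / 2"
  define l where "l = 4 / \<rho>"
  define M where "M = (a + 1) / \<eta>\<^sup>2"
  have pos: "0 < \<eta>" "0 < l" "0 < M" using \<rho>(1) \<open>0 < a\<close> by (simp_all add: \<eta>_def l_def M_def)
  obtain K where K: "\<And>x. \<bar>x\<bar> \<le> 2 \<Longrightarrow> - K \<le> frac_lap s barrier x"
  proof -
    obtain K1 K2 where K1: "\<And>x. \<bar>x\<bar> \<le> 2 \<Longrightarrow> - K1 \<le> frac_lap s barrier_log x"
      and K2: "\<And>x. \<bar>x\<bar> \<le> 2 \<Longrightarrow> - K2 \<le> frac_lap s barrier_bump x"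
      using admissible_frac_lap_bounded[OF admissible_log assms(3,4)]
        admissible_frac_lap_bounded[OF admissible_bump assms(3,4)] by metis
    have "- (K1 + 4 * K2) \<le> frac_lap s barrier x" if "\<bar>x\<bar> \<le> 2" for x
      using K1[OF that] K2[OF that] unfolding frac_lap_barrier[OF assms(3,4)] by linarith
    then show ?thesis using that by blast
  qed
  \<comment> \<open>For \<open>\<bar>l * t\<bar> \<le> 2\<close> the operator term is at least
    \<open>- \<delta> * Q\<close>; the added 1 keeps \<open>Q\<close> positive. \<delta> is then
    half of what would balance \<open>(a / 2) powr p\<close>.\<close>
  define Q where "Q = C s * l powr (2 * s) * (\<bar>K\<bar> + 1)"
  have "0 < Q" using \<open>0 < C s\<close> pos by (simp add: Q_def)
  define \<delta> where "\<delta> = (a / 2) powr p / (2 * Q)"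
  have "0 < \<delta>" using \<open>0 < Q\<close> \<open>0 < a\<close> by (simp add: \<delta>_def)
  have "\<delta> * Q < (a / 2) powr p" using \<open>0 < Q\<close> \<open>0 < a\<close> by (simp add: \<delta>_def)
  define F where "F = (\<lambda>t. \<delta> * barrier (l * t))"
  define \<Phi> where "\<Phi> = ridge j x0 M F"
  obtain b b' where b: "\<And>x. (barrier has_real_derivative b x) (at x)"
    "\<And>x. (b has_real_derivative b' x) (at x)" "continuous_on UNIV b'" "\<And>x. \<bar>b' x\<bar> \<le> 30"
    using barrier_derivs by blast
  have F1: "(F has_real_derivative \<delta> * l * b (l * t)) (at t)" for t
    unfolding F_def by (auto intro!: derivative_eq_intros DERIV_chain2[OF b(1)])
  have F2: "((\<lambda>t. \<delta> * l * b (l * t)) has_real_derivative \<delta> * l\<^sup>2 * b' (l * t)) (at t)" for t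
    by (auto intro!: derivative_eq_intros DERIV_chain2[OF b(2)] simp: power2_eq_square)
  have F3: "continuous_on UNIV (\<lambda>t. \<delta> * l\<^sup>2 * b' (l * t))"
    by (intro continuous_intros continuous_on_compose2[OF b(3)]) auto
  have F4: "\<bar>\<delta> * l\<^sup>2 * b' (l * t)\<bar> \<le> \<delta> * l\<^sup>2 * 30" for t
    using b(4)[of "l * t"] \<open>0 < \<delta>\<close> by (simp add: abs_mult mult_left_mono)
  have F_cont: "continuous_on UNIV F" using F1 by (auto simp: continuous_on_eq_continuous_at intro: DERIV_isCont)
  have \<Phi>_cont: "continuous_on UNIV \<Phi>"
    unfolding \<Phi>_def ridge_def[abs_def] by (intro continuous_intros continuous_on_compose2[OF F_cont]) auto
  \<comment> \<open>After multiplication by \<delta> the threshold becomes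
    \<open>4 * \<delta> - a\<close>, which is \<open>a\<close> below the central value of
    \<Phi>.\<close>
  obtain R where R: "0 \<le> R" "\<And>x. R < \<bar>x\<bar> \<Longrightarrow> barrier x < 4 - a / \<delta>"
    using barrier_unbounded by blast
  define N where "N = (\<lambda>z. norm (z - x0) ^ 2 - ((z - x0) $ j)\<^sup>2)"
  have N0: "((z - x0) $ k)\<^sup>2 \<le> N z" for z
    using components_le_norm[OF j, of "z - x0"] unfolding N_def by linarith
  then have N_nonneg: "0 \<le> N z" for z by (meson order_trans zero_le_power2)
  \<comment> \<open>A solid cylinder about the line: leaving it lengthwise lowers the profile,
    leaving it sideways raises the penalty, and either way \<Phi> falls by at least
    \<open>a\<close>.\<close>
  define A where "A = {z. \<bar>(z - x0) $ j\<bar> \<le> R / l \<and> N z \<le> \<eta>\<^sup>2}"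
  have "x0 \<in> A" using R(1) pos by (simp add: A_def N_def)
  have "compact A"
    unfolding compact_eq_bounded_closed
  proof
    have "norm (z - x0) \<le> sqrt ((R / l)\<^sup>2 + \<eta>\<^sup>2)" if "z \<in> A" for z
    proof -
      have "((z - x0) $ j)\<^sup>2 \<le> (R / l)\<^sup>2"
        using that power_mono[of "\<bar>(z - x0) $ j\<bar>" "R / l" 2] by (simp add: A_def)
      then show ?thesis using that by (intro real_le_rsqrt) (simp add: A_def N_def)
    qed
    then have "A \<subseteq> cball x0 (sqrt ((R / l)\<^sup>2 + \<eta>\<^sup>2))" by (auto simp: dist_norm norm_minus_commute)
    then show "bounded A" using bounded_cball bounded_subset by blast
    show "closed A" unfolding A_def N_def
      by (intro closed_Collect_conj closed_Collect_le continuous_intros)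
  qed
  have A_sub: "z \<in> half_space k" if "N z \<le> \<eta>\<^sup>2" for z
  proof -
    \<comment> \<open>This point of the ball of radius \<rho> shows that \<open>x0\<close> is
      farther than \<eta> from the boundary.\<close>
    have "x0 - \<eta> *\<^sub>R axis k 1 \<in> half_space k"
      using \<rho>(1) \<rho>(2)[of "x0 - \<eta> *\<^sub>R axis k 1"] by (simp add: dist_norm \<eta>_def)
    then have "\<eta> < x0 $ k" by (simp add: half_space_def)
    moreover have "\<bar>(z - x0) $ k\<bar> \<le> \<eta>"
      using N0[of z] that pos by (intro abs_le_square_iff[THEN iffD2, of _ \<eta>, simplified abs_of_pos[OF pos(1)]]) simp
    ultimately show ?thesis by (simp add: half_space_def)
  qed
  have "\<exists>x\<in>A. \<forall>y\<in>A. u x - \<Phi> x \<le> u y - \<Phi> y"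
  proof (rule compact_attains_min_lsc[OF \<open>compact A\<close>])
    fix x y assume "x \<in> A" and y: "y < u x - \<Phi> x"
    define \<epsilon> where "\<epsilon> = (u x - \<Phi> x - y) / 2"
    have "0 < \<epsilon>" using y by (simp add: \<epsilon>_def)
    have "eventually (\<lambda>z. u x - \<epsilon> < u z) (nhds x)"
      using \<open>x \<in> A\<close> \<open>0 < \<epsilon>\<close> by (intro lsc A_sub) (auto simp: A_def)
    moreover have "eventually (\<lambda>z. \<Phi> z < \<Phi> x + \<epsilon>) (nhds x)"
    proof -
      have "(\<Phi> \<longlongrightarrow> \<Phi> x) (nhds x)"
        using \<Phi>_cont by (simp add: continuous_on_eq_continuous_at continuous_at tendsto_at_iff_tendsto_nhds)
      from order_tendstoD(2)[OF this, of "\<Phi> x + \<epsilon>"] \<open>0 < \<epsilon>\<close> show ?thesis by simp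
    qed
    ultimately show "eventually (\<lambda>z. y < u z - \<Phi> z) (nhds x)"
      by eventually_elim (simp add: \<epsilon>_def field_simps)
  qed (use \<open>x0 \<in> A\<close> in auto)
  then obtain x where x: "x \<in> A" "\<And>y. y \<in> A \<Longrightarrow> u x - \<Phi> x \<le> u y - \<Phi> y" by blast
  have \<Phi>: "\<Phi> z = \<delta> * barrier (l * (z - x0) $ j) - M * N z" for z
    by (simp add: \<Phi>_def ridge_def F_def N_def)
  have \<Phi>x0: "\<Phi> x0 = 4 * \<delta>" by (simp add: \<Phi> N_def barrier_0)
  \<comment> \<open>Off the cylinder, \<open>u z - \<Phi> z\<close> is at least
    \<open>a - 4 * \<delta>\<close>, its value at \<open>x0\<close>, because \<open>u z\<close> is
    nonnegative. So the minimum over \<open>A\<close> is global.\<close>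
  have min: "u x - \<Phi> x \<le> u z - \<Phi> z" for z
  proof (cases "z \<in> A")
    case False
    have "\<Phi> z \<le> 4 * \<delta> - a"
    proof (cases "N z \<le> \<eta>\<^sup>2")
      case True
      then have "R / l < \<bar>(z - x0) $ j\<bar>" using False by (auto simp: A_def)
      then have "R < \<bar>l * (z - x0) $ j\<bar>" using pos by (simp add: abs_mult divide_less_eq mult.commute)
      from R(2)[OF this] have "\<delta> * barrier (l * (z - x0) $ j) \<le> \<delta> * (4 - a / \<delta>)"
        using \<open>0 < \<delta>\<close> by (intro mult_left_mono) auto
      also have "\<dots> = 4 * \<delta> - a" using \<open>0 < \<delta>\<close> by (simp add: field_simps)
      finally show ?thesis using mult_nonneg_nonneg[OF less_imp_le[OF pos(3)] N_nonneg[of z]] unfolding \<Phi> by linarith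
    next
      case False
      then have "M * \<eta>\<^sup>2 \<le> M * N z" using pos by (intro mult_left_mono) auto
      moreover have "M * \<eta>\<^sup>2 = a + 1" using pos by (simp add: M_def)
      moreover have "\<delta> * barrier (l * (z - x0) $ j) \<le> \<delta> * 4"
        using \<open>0 < \<delta>\<close> barrier_le_4 by (intro mult_left_mono) auto
      ultimately show ?thesis unfolding \<Phi> by linarith
    qed
    then have "u x0 - \<Phi> x0 \<le> u z - \<Phi> z" using assms(6)[of z] \<Phi>x0 by (simp add: a_def)
    with x(2)[OF \<open>x0 \<in> A\<close>] show ?thesis by simp
  qed (use x in simp)
  define c where "c = u x - \<Phi> x"
  define \<phi> where "\<phi> = ridge j x0 M (\<lambda>t. F t + c)"
  have \<phi>: "\<phi> z = \<Phi> z + c" for z by (simp add: \<phi>_def \<Phi>_def ridge_def)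
  define t where "t = (x - x0) $ j"
  have x_hs: "x \<in> half_space k" using x A_sub by (simp add: A_def)
  have "C s * frac_lap s F t + u x powr p \<le> 0"
  \<comment> \<open>The radius \<open>x $ k\<close> is the distance to the boundary, and
    \<open>K\<close> is twice the bound on the second derivative of \<open>F\<close>.\<close>
  proof (rule visc_supersol_one_direction[where f = "\<lambda>x t. t powr p" and \<Omega> = "half_space k" and \<phi> = \<phi>
          and r = "x $ k" and K = "2 * (\<delta> * l\<^sup>2 * 30)" and e = "axis j 1"])
    show "visc_supersol s (half_space k) (I1_plus C s) (\<lambda>x t. t powr p) u"
      using assms(7) by (simp add: visc_supersol_Dirichlet_def)
    show "0 < x $ k" using x_hs by (simp add: half_space_def)
    show "ball x (x $ k) \<subseteq> half_space k"
    proof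
      fix z assume "z \<in> ball x (x $ k)"
      then have "\<bar>(x - z) $ k\<bar> < x $ k"
        using component_le_norm_cart[of "x - z" k] by (simp add: dist_norm)
      then show "z \<in> half_space k" by (simp add: half_space_def)
    qed
    show "C2_closure (ball x (x $ k)) \<phi>"
      unfolding \<phi>_def
    proof (rule C2_closure_ridge[OF _ F2 F3])
      show "((\<lambda>t. F t + c) has_real_derivative \<delta> * l * b (l * t)) (at t)" for t
        using DERIV_add[OF F1 DERIV_const, of c t] by simp
    qed
    show "continuous_on UNIV \<phi>" unfolding \<phi>[abs_def] by (intro continuous_intros \<Phi>_cont)
    show "\<phi> x = u x" by (simp add: \<phi> c_def)
    show "\<phi> z \<le> u z" for z using min[of z] by (simp add: \<phi> c_def)
    show "0 \<le> 2 * (\<delta> * l\<^sup>2 * 30)" using \<open>0 < \<delta>\<close> by simp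
    have second: "\<phi> (x + \<tau> *\<^sub>R \<xi>) + \<phi> (x - \<tau> *\<^sub>R \<xi>) - 2 * \<phi> x =
        sdiff F t (\<tau> * \<xi> $ j) - 2 * M * \<tau>\<^sup>2 * (1 - (\<xi> $ j)\<^sup>2)" if "norm \<xi> = 1" for \<xi> \<tau>
      using ridge_second_difference[OF that, of j x0 M F x \<tau>] by (simp add: \<phi> \<Phi>_def t_def)
    show "\<phi> (x + \<tau> *\<^sub>R \<xi>) + \<phi> (x - \<tau> *\<^sub>R \<xi>) - 2 * \<phi> x \<le> 2 * (\<delta> * l\<^sup>2 * 30) * \<tau>\<^sup>2"
      if "norm \<xi> = 1" "0 < \<tau>" for \<xi> \<tau>
    proof -
      have "\<bar>\<xi> $ j\<bar> \<le> 1" using component_le_norm_cart[of \<xi> j] that by simp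
      then have 1: "(\<xi> $ j)\<^sup>2 \<le> 1" by (simp add: abs_square_le_1)
      \<comment> \<open>Second differences are even in the increment, so the bound for nonnegative
        increments applies.\<close>
      have "sdiff F t (\<tau> * \<xi> $ j) = sdiff F t (\<tau> * \<bar>\<xi> $ j\<bar>)" by (simp add: sdiff_def abs_if)
      also have "\<dots> \<le> 2 * (\<delta> * l\<^sup>2 * 30) * (\<tau> * \<bar>\<xi> $ j\<bar>)\<^sup>2"
        using sdiff_quadratic_bound[OF F1 F2 F4, of "\<tau> * \<bar>\<xi> $ j\<bar>" t] that by (simp add: abs_le_iff)
      also have "\<dots> \<le> 2 * (\<delta> * l\<^sup>2 * 30) * (\<tau>\<^sup>2 * 1)"
        using 1 \<open>0 < \<delta>\<close> by (intro mult_left_mono) (auto simp: power_mult_distrib mult_left_le)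
      finally have "sdiff F t (\<tau> * \<xi> $ j) \<le> 2 * (\<delta> * l\<^sup>2 * 30) * \<tau>\<^sup>2" by simp
      moreover have "0 \<le> 2 * M * \<tau>\<^sup>2 * (1 - (\<xi> $ j)\<^sup>2)" using 1 pos by simp
      ultimately show ?thesis unfolding second[OF that(1)] by linarith
    qed
    show "norm (axis j (1::real) :: real ^ 'n) = 1" by simp
    show "sdiff F t \<tau> = \<phi> (x + \<tau> *\<^sub>R axis j 1) + \<phi> (x - \<tau> *\<^sub>R axis j 1) - 2 * \<phi> x" for \<tau>
      using second[of "axis j 1" \<tau>] by simp
    show "set_integrable lebesgue {0<..} (\<lambda>\<tau>. sdiff F t \<tau> / \<tau> powr (1 + 2 * s))"
      unfolding F_def by (rule frac_lap_rescale(2)[OF pos(2) barrier_integrable[OF assms(3,4)]])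
  qed (use assms \<open>0 < C s\<close> x_hs in auto)
  moreover have "frac_lap s F t = \<delta> * l powr (2 * s) * frac_lap s barrier (l * t)"
    unfolding F_def by (rule frac_lap_rescale(1)[OF pos(2)])
  ultimately have main: "C s * (\<delta> * l powr (2 * s) * frac_lap s barrier (l * t)) + u x powr p \<le> 0" by simp
  have coeff: "0 < C s * (\<delta> * l powr (2 * s))" using \<open>0 < C s\<close> \<open>0 < \<delta>\<close> pos by simp
  show False
  proof (cases "2 \<le> \<bar>l * t\<bar>")
    case True
    have "0 < C s * (\<delta> * l powr (2 * s)) * frac_lap s barrier (l * t)"
      using coeff frac_lap_barrier_pos[OF assms(3,4) True] by (rule mult_pos_pos)
    moreover have "0 \<le> u x powr p" by simp
    ultimately show False using main by (simp add: mult.assoc)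
  next
    case False
    then have "\<bar>t\<bar> < \<eta>" using pos \<rho>(1) by (simp add: abs_mult l_def \<eta>_def field_simps)
    then have "t\<^sup>2 < \<eta>\<^sup>2" using power_strict_mono[of "\<bar>t\<bar>" \<eta> 2] by simp
    moreover have "norm (x - x0) ^ 2 = N x + t\<^sup>2" by (simp add: N_def t_def)
    moreover have "N x \<le> \<eta>\<^sup>2" using x by (simp add: A_def)
    moreover have "2 * \<eta>\<^sup>2 \<le> \<rho>\<^sup>2" by (simp add: \<eta>_def power2_eq_square)
    ultimately have "norm (x - x0) ^ 2 < \<rho>\<^sup>2" by linarith
    then have "dist x x0 < \<rho>" using \<rho>(1) by (simp add: dist_norm power2_less_imp_less)
    then have "a / 2 < u x" using \<rho>(2) by blast
    then have "(a / 2) powr p \<le> u x powr p" using \<open>0 < a\<close> assms(8) by (intro powr_mono2) auto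
    moreover have "- (\<bar>K\<bar> + 1) \<le> frac_lap s barrier (l * t)" using K[of "l * t"] False by linarith
    then have "C s * (\<delta> * l powr (2 * s)) * - (\<bar>K\<bar> + 1) \<le> C s * (\<delta> * l powr (2 * s)) * frac_lap s barrier (l * t)"
      using coeff by (intro mult_left_mono) auto
    then have "- (\<delta> * Q) \<le> C s * (\<delta> * l powr (2 * s) * frac_lap s barrier (l * t))"
      by (simp only: Q_def mult_ac mult_minus_left mult_minus_right)
    ultimately show False using main \<open>\<delta> * Q < (a / 2) powr p\<close> by linarith
  qed
qed

end
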